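(* Let $\mathbf{i}=\bigl((1),(1)\bigr)$. The map $w\mapsto w(\mathbf{i})$ is a bijection from $\mathcal{M}_{\mathbf{i}}=\{w\in\mathcal{M} : w(\mathbf{i})\neq\mathbf{o}\}$ onto $\widetilde{\mathcal{F}}$, the set of pairs of compositions corresponding to Frobenius standard seaweed subalgebras.
   Context: $\Bbbk$ is an algebraically closed field of characteristic zero; $\mathbb{N}=\{0,1,2,\dots\}$, $\mathbb{N}^*=\mathbb{N}\setminus\{0\}$. For $n\in\mathbb{N}^*$, $\mathcal{C}_n$ is the set of compositions of $n$, i.e. finite sequences $(a_1,\dots,a_r)$ ($r\ge1$) of positive integers with sum $n$; $p(\cdot)$ denotes the number of parts. Put $\widetilde{\mathcal{C}}=\bigcup_{n\in\mathbb{N}^*}\mathcal{C}_n\times\mathcal{C}_n$. An element is written $\mathbf{a}=(\mathbf{a}^+,\mathbf{a}^-)$ with $\mathbf{a}^\pm=(a_1^\pm,\dots,a^\pm_{p(\mathbf{a}^\pm)})$. Add a null element $\mathbf{o}$: $\overline{\mathcal{C}}=\widetilde{\mathcal{C}}\cup\{\mathbf{o}\}$. Seaweed algebras: for $\mathbf{c}\in\mathcal{C}_n$, $\mathfrak{p}_{\mathbf{c}}$ is the Lie algebra of trace-zero $n\times n$ matrices over $\Bbbk$ that are block upper triangular with diagonal block sizes given by $\mathbf{c}$. For $\mathbf{a}\in\mathcal{C}_n\times\mathcal{C}_n$, the standard seaweed subalgebra of $\mathrm{sl}_n(\Bbbk)$ is $\mathfrak{p}_{\mathbf{a}}=\mathfrak{p}_{\mathbf{a}^+}\cap{}^t\mathfrak{p}_{\mathbf{a}^-}$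 (${}^t$ = set of transposes). The index of a Lie algebra $\mathfrak{g}$ is $\min_{f\in\mathfrak{g}^*}\dim\{x\in\mathfrak{g}: f([x,y])=0\ \forall y\in\mathfrak{g}\}$; Frobenius means index $0$. $\widetilde{\mathcal{F}}=\{\mathbf{a}\in\widetilde{\mathcal{C}} : \mathfrak{p}_{\mathbf{a}}\text{ is Frobenius}\}$. Operators on $\overline{\mathcal{C}}$, for $m\in\mathbb{N}$; each fixes $\mathbf{o}$, and for $\mathbf{a}\in\widetilde{\mathcal{C}}$: - $\rho(\mathbf{a})=(\mathbf{a}^-,\mathbf{a}^+)$; - $\sigma_m^+(\mathbf{a})=\bigl(((m+2)a_1^+,a_2^+,\dots,a^+_{p(\mathbf{a}^+)}),\ ((m+1)a_1^+,a_1^-,\dots,a^-_{p(\mathbf{a}^-)})\bigr)$; - $\tau_m^+(\mathbf{a})=\bigl(((m+1)a_1^++(m+2)a_2^+,a_3^+,\dots,a^+_{p(\mathbf{a}^+)}),\ (ma_1^++(m+1)a_2^+,a_1^-,\dots,a^-_{p(\mathbf{a}^-)})\bigr)$ if $p(\mathbf{a}^+)>1$, and $\tau_m^+(\mathbf{a})=\mathbf{o}$ if $p(\mathbf{a}^+)=1$; - $\sigma_m^-=\rho\sigma_m^+\rho$, $\tau_m^-=\rho\tau_m^+\rho$. Let $\mathcal{A}=\{\sigma_m^{\pm},\tau_m^{\pm} : m\in\mathbb{N}\}$ and let $\mathcal{M}$ be the submonoid generated by $\mathcal{A}$ in the monoid (under composition) of maps $\overline{\mathcal{C}}\to\overline{\mathcal{C}}$;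 it contains the identity map. *)

theory Defs
  imports
    "HOL-Computational_Algebra.Polynomial"
    "Jordan_Normal_Form.VS_Connect"
begin

definition compositions :: "nat \<Rightarrow> nat list set" where
  "compositions n = {c. c \<noteq> [] \<and> (\<forall>x\<in>set c. 0 < x) \<and> sum_list c = n}"

typedef comp_pair = "\<Union>n\<in>{1..}. compositions n \<times> compositions n"
proof
  show "([1], [1]) \<in> (\<Union>n\<in>{1..}. compositions n \<times> compositions n)"
    by (auto simp: compositions_def)
qed

setup_lifting type_definition_comp_pair

lift_definition plus_part :: "comp_pair \<Rightarrow> nat list" is fst .
lift_definition minus_part :: "comp_pair \<Rightarrow> nat list" is snd .

definition pair_size :: "comp_pair \<Rightarrow> nat" where
  "pair_size a = sum_list (plus_part a)"

lift_definition unit_pair :: comp_pair is "([1], [1])"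
  by (auto simp: compositions_def)

subsection \<open>Seaweed algebras\<close>

text \<open>Rows and columns are numbered from 0; \<open>block_index c i\<close> is the (0-based) number of the
  block of \<open>c\<close> containing position \<open>i < sum_list c\<close>.\<close>

definition block_index :: "nat list \<Rightarrow> nat \<Rightarrow> nat" where
  "block_index c i = (LEAST r. i < sum_list (take (Suc r) c))"

definition parabolic :: "nat list \<Rightarrow> 'k::field mat set" where
  "parabolic c = {A \<in> carrier_mat (sum_list c) (sum_list c).
     (\<Sum>i<sum_list c. A $$ (i, i)) = 0 \<and>
     (\<forall>i<sum_list c. \<forall>j<sum_list c. block_index c j < block_index c i \<longrightarrow> A $$ (i, j) = 0)}"

definition seaweed :: "comp_pair \<Rightarrow> 'k::field mat set" where
  "seaweed a = parabolic (plus_part a) \<inter> transpose_mat ` parabolic (minus_part a)"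

definition commutator :: "'k::field mat \<Rightarrow> 'k mat \<Rightarrow> 'k mat" where
  "commutator x y = x * y - y * x"

text \<open>Linear forms on \<open>V\<close>, represented by functions on the whole carrier type. Their values
  outside \<open>carrier V\<close> are arbitrary and play no role below.\<close>

definition linear_forms :: "('k::field, 'v) module \<Rightarrow> ('v \<Rightarrow> 'k) set" where
  "linear_forms V = {f.
     (\<forall>x\<in>carrier V. \<forall>y\<in>carrier V. f (x \<oplus>\<^bsub>V\<^esub> y) = f x + f y) \<and>
     (\<forall>c. \<forall>x\<in>carrier V. f (c \<odot>\<^bsub>V\<^esub> x) = c * f x)}"

text \<open>The index of the Lie algebra with underlying vector space \<open>V\<close> and bracket \<open>br\<close>.\<close>

definition lie_index :: "('k::field, 'v) module \<Rightarrow> ('v \<Rightarrow> 'v \<Rightarrow> 'v) \<Rightarrow> nat" where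
  "lie_index V br = (LEAST d. \<exists>f\<in>linear_forms V.
     d = vectorspace.dim class_ring
           (V\<lparr>carrier := {x \<in> carrier V. \<forall>y\<in>carrier V. f (br x y) = 0}\<rparr>))"

definition seaweed_space :: "comp_pair \<Rightarrow> ('k::field, 'k mat) module" where
  "seaweed_space a =
     (module_mat TYPE('k) (pair_size a) (pair_size a))\<lparr>carrier := seaweed a\<rparr>"

definition frobenius_pairs :: "'k::field itself \<Rightarrow> comp_pair set" where
  "frobenius_pairs _ = {a. lie_index (seaweed_space a :: ('k, 'k mat) module) commutator = 0}"

subsection \<open>The operators\<close>

text \<open>Pairs of compositions together with the null element, which is \<^term>\<open>None\<close>.\<close>

type_synonym cbar = "comp_pair option"

lift_definition swap_pair :: "comp_pair \<Rightarrow> comp_pair" is "\<lambda>(p, q). (q, p)"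
  by auto

lift_definition sigma_pair :: "nat \<Rightarrow> comp_pair \<Rightarrow> comp_pair" is
  "\<lambda>m (p, q). (((m + 2) * hd p) # tl p, ((m + 1) * hd p) # q)"
proof -
  fix m :: nat and a :: "nat list \<times> nat list"
  assume "a \<in> (\<Union>n\<in>{1..}. compositions n \<times> compositions n)"
  then show "(case a of (p, q) \<Rightarrow> (((m + 2) * hd p) # tl p, ((m + 1) * hd p) # q))
      \<in> (\<Union>n\<in>{1..}. compositions n \<times> compositions n)"
    by (cases a; cases "fst a") (auto simp: compositions_def algebra_simps)
qed

text \<open>The second equation only makes \<open>tau_raw\<close> total; \<open>tau_plus\<close> below returns the null
  element when the plus part has a single entry.\<close>

fun tau_raw :: "nat \<Rightarrow> nat list \<times> nat list \<Rightarrow> nat list \<times> nat list" where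
  "tau_raw m (x # y # p, q) = (((m + 1) * x + (m + 2) * y) # p, (m * x + (m + 1) * y) # q)"
| "tau_raw m a = a"

lift_definition tau_pair :: "nat \<Rightarrow> comp_pair \<Rightarrow> comp_pair" is tau_raw
proof -
  fix m :: nat and a :: "nat list \<times> nat list"
  assume "a \<in> (\<Union>n\<in>{1..}. compositions n \<times> compositions n)"
  then show "tau_raw m a \<in> (\<Union>n\<in>{1..}. compositions n \<times> compositions n)"
    by (cases "(m, a)" rule: tau_raw.cases) (auto simp: compositions_def algebra_simps)
qed

definition rho :: "cbar \<Rightarrow> cbar" where
  "rho = map_option swap_pair"

definition sigma_plus :: "nat \<Rightarrow> cbar \<Rightarrow> cbar" where
  "sigma_plus m = map_option (sigma_pair m)"

definition tau_plus :: "nat \<Rightarrow> cbar \<Rightarrow> cbar" where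
  "tau_plus m x = Option.bind x
     (\<lambda>a. if length (plus_part a) > 1 then Some (tau_pair m a) else None)"

definition sigma_minus :: "nat \<Rightarrow> cbar \<Rightarrow> cbar" where
  "sigma_minus m = rho \<circ> sigma_plus m \<circ> rho"

definition tau_minus :: "nat \<Rightarrow> cbar \<Rightarrow> cbar" where
  "tau_minus m = rho \<circ> tau_plus m \<circ> rho"

definition generators :: "(cbar \<Rightarrow> cbar) set" where
  "generators = range sigma_plus \<union> range sigma_minus \<union> range tau_plus \<union> range tau_minus"

inductive_set operator_monoid :: "(cbar \<Rightarrow> cbar) set" where
  one: "id \<in> operator_monoid"
| gen: "g \<in> generators \<Longrightarrow> g \<in> operator_monoid"
| mult: "v \<in> operator_monoid \<Longrightarrow> w \<in> operator_monoid \<Longrightarrow> v \<circ> w \<in> operator_monoid"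

end

theory Submission
  imports Defs
begin

text \<open>A seaweed algebra is Frobenius exactly when it can be peeled down to \<open>sl\<^sub>1 = 0\<close>, and the
  operators \<open>\<sigma>\<close> and \<open>\<tau>\<close> are the inverses of the peeling steps; since a pair of compositions
  shows by its two first parts which operator was applied last, the peeling is deterministic, and
  so words in the operators correspond bijectively to Frobenius pairs.

  Seaweeds as associative algebras. Dropping the trace condition turns a seaweed into the
  associative algebra of all matrices supported on a preorder \<open>R\<close> (a pattern algebra). In
  characteristic zero the index is zero if and only if some form \<open>x \<mapsto> tr (F x)\<close> has only the scalar
  matrices in the radical of \<open>(x, y) \<mapsto> tr (F (x y - y x))\<close>; this is \<open>frobenius_pairs_iff\<close>. From there
  on everything is a statement about matrices with prescribed zeros.

  One peeling step. Let the first parts be \<open>t + v\<close> above and \<open>t > 0\<close> below. The first \<open>t\<close> positions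
  \<open>T\<close> form a full matrix block, the remaining positions \<open>J\<close> carry a smaller seaweed, and the only
  other entries are those in \<open>V \<times> T\<close>, where \<open>V\<close> consists of the \<open>v\<close> positions following \<open>T\<close>. The
  corresponding corner \<open>\<beta>\<close> of \<open>F\<close> is a \<open>t \<times> v\<close> matrix on which the invertible elements of the algebra
  realise all row operations and all lower triangular column operations, so \<open>\<beta>\<close> can be made a partial permutation
  matrix (\<open>exists_matched_form\<close>). If \<open>\<beta>\<close> had both a zero row and a zero column, a single matrix
  unit would lie in the radical; the same argument shows that the matched columns dominate the
  unmatched ones (\<open>unmatched_column\<close>). With \<open>\<beta>\<close> in this form the equations for the radical can be
  solved: part of them identifies the block at \<open>T\<close> with a block of the rest, part of them determines
  the corner, and what remains are the equations for a form on a smaller pattern algebra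
  (\<open>frobenius_form_iff_reduced\<close>). For seaweeds the smaller pattern is \<open>(t, p | t - v, q)\<close> if
  \<open>v \<le> t\<close> (without the part \<open>t - v\<close> if it is zero), and \<open>(v - t, t, p | q)\<close> if \<open>t < v\<close>. Applying \<open>m\<close>
  steps with \<open>v < t\<close> and then one step with \<open>v = t\<close> undoes \<open>\<sigma>\<^sub>m\<close>; ending with a step with \<open>t < v\<close> instead
  undoes \<open>\<tau>\<^sub>m\<close> (\<open>frobenius_seaweed_sigma\<close>, \<open>frobenius_seaweed_tau\<close>). If the larger first part is below,
  transpose.

  Equal first parts. Then the first block is a direct factor, and its identity is a central element;
  so a Frobenius pair with equal first parts consists of a single block, and a full matrix algebra
  is Frobenius only in size one (\<open>frobenius_seaweed_equal_first_parts\<close>).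

  Reading off the operator. If \<open>s > t > 0\<close> are the first parts and \<open>d = s - t\<close>, then division of \<open>t\<close> by
  \<open>d\<close> decides: remainder zero means \<open>\<sigma>\<^sub>m\<close> with \<open>m + 1 = t div d\<close>, and remainder \<open>y > 0\<close> means \<open>\<tau>\<^sub>m\<close>
  with \<open>m = t div d\<close>. This gives uniqueness (\<open>generator_inject\<close>) and existence
  (\<open>generator_onto\<close>) of the last letter of a word.\<close>

section \<open>Linear forms on pattern algebras\<close>

text \<open>When \<open>R\<close> is a preorder on \<open>I\<close> this is the incidence algebra of \<open>R\<close>.\<close>

definition pattern_algebra :: "'i set \<Rightarrow> ('i \<Rightarrow> 'i \<Rightarrow> bool) \<Rightarrow> ('i \<Rightarrow> 'i \<Rightarrow> 'k::field) set" where
  "pattern_algebra I R = {x. \<forall>i j. x i j \<noteq> 0 \<longrightarrow> i \<in> I \<and> j \<in> I \<and> R i j}"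

definition mprod :: "'i set \<Rightarrow> ('i \<Rightarrow> 'i \<Rightarrow> 'k::field) \<Rightarrow> ('i \<Rightarrow> 'i \<Rightarrow> 'k) \<Rightarrow> 'i \<Rightarrow> 'i \<Rightarrow> 'k" where
  "mprod I x y i j = (\<Sum>k\<in>I. x i k * y k j)"

text \<open>The matrix \<open>F\<close> stands for the linear form \<open>x \<mapsto> tr (F x)\<close>, and its stabilizer is the radical of
  \<open>(x, y) \<mapsto> tr (F (x y - y x))\<close>: the condition is tested on the matrix units \<open>y\<close> at the positions
  \<open>(i, j)\<close> of the pattern. For transitive \<open>R\<close> it depends only on the values \<open>F j i\<close> with \<open>R i j\<close>
  (\<open>stabilizer_cong\<close>).\<close>

definition stabilizer :: "'i set \<Rightarrow> ('i \<Rightarrow> 'i \<Rightarrow> bool) \<Rightarrow> ('i \<Rightarrow> 'i \<Rightarrow> 'k::field) \<Rightarrow> ('i \<Rightarrow> 'i \<Rightarrow> 'k) set" where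
  "stabilizer I R F = {x \<in> pattern_algebra I R.
     \<forall>i\<in>I. \<forall>j\<in>I. R i j \<longrightarrow> mprod I F x j i = mprod I x F j i}"

definition scalar_on :: "'i set \<Rightarrow> ('i \<Rightarrow> 'i \<Rightarrow> 'k::field) \<Rightarrow> bool" where
  "scalar_on I x \<longleftrightarrow> (\<exists>c. \<forall>i\<in>I. \<forall>j\<in>I. x i j = (if i = j then c else 0))"

text \<open>The identity matrix is central, so scalar matrices lie in every stabilizer; they take the place
  of the zero element of the Lie algebra of traceless matrices.\<close>

definition frobenius_form :: "'i set \<Rightarrow> ('i \<Rightarrow> 'i \<Rightarrow> bool) \<Rightarrow> ('i \<Rightarrow> 'i \<Rightarrow> 'k::field) \<Rightarrow> bool" where
  "frobenius_form I R F \<longleftrightarrow> (\<forall>x\<in>stabilizer I R F. scalar_on I x)"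

definition frobenius_pattern :: "'k::field itself \<Rightarrow> 'i set \<Rightarrow> ('i \<Rightarrow> 'i \<Rightarrow> bool) \<Rightarrow> bool" where
  "frobenius_pattern _ I R \<longleftrightarrow> (\<exists>F :: 'i \<Rightarrow> 'i \<Rightarrow> 'k. frobenius_form I R F)"

lemma pattern_algebraD:
  assumes "x \<in> pattern_algebra I R" "x i j \<noteq> 0"
  shows "i \<in> I" "j \<in> I" "R i j"
  using assms by (auto simp: pattern_algebra_def)

lemma pattern_algebra_zero:
  assumes "x \<in> pattern_algebra I R" "\<not> (i \<in> I \<and> j \<in> I \<and> R i j)"
  shows "x i j = 0"
  using assms by (auto simp: pattern_algebra_def)

lemma mprod_assoc:
  assumes "finite I"
  shows "mprod I (mprod I x y) z = mprod I x (mprod I y z)"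
proof (intro ext)
  fix i j
  have "mprod I (mprod I x y) z i j = (\<Sum>k\<in>I. \<Sum>l\<in>I. x i l * y l k * z k j)"
    by (simp add: mprod_def sum_distrib_right)
  also have "\<dots> = (\<Sum>l\<in>I. \<Sum>k\<in>I. x i l * y l k * z k j)"
    by (rule sum.swap)
  also have "\<dots> = mprod I x (mprod I y z) i j"
    by (simp add: mprod_def sum_distrib_left mult.assoc)
  finally show "mprod I (mprod I x y) z i j = mprod I x (mprod I y z) i j" .
qed

lemma mprod_in_pattern_algebra:
  assumes "x \<in> pattern_algebra I R" "y \<in> pattern_algebra I R"
    and trans: "\<And>i j k. i \<in> I \<Longrightarrow> j \<in> I \<Longrightarrow> k \<in> I \<Longrightarrow> R i j \<Longrightarrow> R j k \<Longrightarrow> R i k"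
  shows "mprod I x y \<in> pattern_algebra I R"
  unfolding pattern_algebra_def
proof (intro CollectI allI impI)
  fix i j assume "mprod I x y i j \<noteq> 0"
  then obtain k where "k \<in> I" "x i k * y k j \<noteq> 0"
    unfolding mprod_def by (meson sum.not_neutral_contains_not_neutral)
  then show "i \<in> I \<and> j \<in> I \<and> R i j"
    using pattern_algebraD[OF assms(1), of i k] pattern_algebraD[OF assms(2), of k j] trans
    by (metis mult_eq_0_iff)
qed

definition identity_on :: "'i set \<Rightarrow> 'i \<Rightarrow> 'i \<Rightarrow> 'k::field" where
  "identity_on I i j = (if i = j \<and> i \<in> I then 1 else 0)"

lemma mprod_identity:
  assumes "finite I"
  shows "i \<in> I \<Longrightarrow> mprod I (identity_on I) x i j = x i j"
    and "j \<in> I \<Longrightarrow> mprod I x (identity_on I) i j = x i j"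
proof -
  assume "i \<in> I"
  then have "mprod I (identity_on I) x i j = (\<Sum>k\<in>I. if k = i then x i j else 0)"
    unfolding mprod_def by (intro sum.cong) (auto simp: identity_on_def)
  then show "mprod I (identity_on I) x i j = x i j" using assms \<open>i \<in> I\<close> by simp
next
  assume "j \<in> I"
  then have "mprod I x (identity_on I) i j = (\<Sum>k\<in>I. if k = j then x i j else 0)"
    unfolding mprod_def by (intro sum.cong) (auto simp: identity_on_def)
  then show "mprod I x (identity_on I) i j = x i j" using assms \<open>j \<in> I\<close> by simp
qed

lemma mprod_cong:
  assumes "\<And>k. k \<in> I \<Longrightarrow> x i k = x' i k" "\<And>k. k \<in> I \<Longrightarrow> y k j = y' k j"
  shows "mprod I x y i j = mprod I x' y' i j"
  unfolding mprod_def by (rule sum.cong) (auto simp: assms)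

lemma mprod_diff_left: "mprod I (\<lambda>i j. x i j - y i j) z i j = mprod I x z i j - mprod I y z i j"
  by (simp add: mprod_def algebra_simps sum_subtractf)

lemma mprod_diff_right: "mprod I z (\<lambda>i j. x i j - y i j) i j = mprod I z x i j - mprod I z y i j"
  by (simp add: mprod_def algebra_simps sum_subtractf)

text \<open>Invertible elements of the algebra act on it by conjugation, and a stabilizer is moved to a
  stabilizer while scalar matrices stay fixed. This is what permits a change of coordinates for \<open>F\<close>.\<close>

lemma frobenius_form_conj:
  fixes F G H :: "'i \<Rightarrow> 'i \<Rightarrow> 'k::field"
  assumes fin: "finite I"
    and trans: "\<And>i j k. i \<in> I \<Longrightarrow> j \<in> I \<Longrightarrow> k \<in> I \<Longrightarrow> R i j \<Longrightarrow> R j k \<Longrightarrow> R i k"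
    and G: "G \<in> pattern_algebra I R" and H: "H \<in> pattern_algebra I R"
    and GH: "mprod I G H = identity_on I" and HG: "mprod I H G = identity_on I"
    and F: "frobenius_form I R F"
  shows "frobenius_form I R (mprod I G (mprod I F H))"
  unfolding frobenius_form_def
proof
  let ?m = "mprod I"
  let ?F = "?m G (?m F H)"
  note assoc = mprod_assoc[OF fin]
  fix x assume x: "x \<in> stabilizer I R ?F"
  then have xA: "x \<in> pattern_algebra I R" by (simp add: stabilizer_def)
  define z where "z = ?m H (?m x G)"
  have zA: "z \<in> pattern_algebra I R"
    unfolding z_def
    by (rule mprod_in_pattern_algebra[OF H mprod_in_pattern_algebra[OF xA G trans] trans])
  define D where "D = (\<lambda>i j. ?m ?F x i j - ?m x ?F i j)"
  have D0: "D l k = 0" if "k \<in> I" "l \<in> I" "R k l" for k l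
    using x that by (simp add: stabilizer_def D_def)
  \<comment> \<open>Writing \<open>D\<close> for the commutator of the conjugated form with \<open>x\<close>, the commutator of \<open>F\<close> with \<open>z\<close> is \<open>H D G\<close>,
    and conjugation by elements of the algebra preserves the vanishing on the transposed pattern.\<close>
  have "z \<in> stabilizer I R F"
    unfolding stabilizer_def
  proof (intro CollectI conjI zA ballI impI)
    fix i j assume ij: "i \<in> I" "j \<in> I" "R i j"
    have a: "?m F z j i = ?m H (?m (?m ?F x) G) j i"
    proof -
      have "?m H (?m (?m ?F x) G) = ?m (?m H G) (?m F z)"
        by (simp add: assoc z_def)
      then show ?thesis using HG ij by (simp add: mprod_identity[OF fin])
    qed
    have b: "?m z F j i = ?m H (?m (?m x ?F) G) j i"
    proof -
      have "?m H (?m (?m x ?F) G) = ?m (?m z F) (?m H G)"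
        by (simp add: assoc z_def)
      then show ?thesis using HG ij by (simp add: mprod_identity[OF fin])
    qed
    have "?m F z j i - ?m z F j i = ?m H (?m D G) j i"
    proof -
      have "?m D G = (\<lambda>a b. ?m (?m ?F x) G a b - ?m (?m x ?F) G a b)"
        by (intro ext) (simp add: D_def mprod_diff_left)
      then show ?thesis by (simp add: a b mprod_diff_right)
    qed
    also have "\<dots> = 0"
      unfolding mprod_def sum_distrib_left
    proof (intro sum.neutral ballI)
      fix k l assume kl: "k \<in> I" "l \<in> I"
      show "H j k * (D k l * G l i) = 0"
      proof (cases "H j k = 0 \<or> G l i = 0")
        case False
        then have "R j k" "R l i"
          using pattern_algebraD(3)[OF H, of j k] pattern_algebraD(3)[OF G, of l i] by auto
        then have "R l k"
          using trans[of l i j] trans[of l j k] kl ij by simp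
        then show ?thesis using D0 kl by simp
      qed auto
    qed
    finally show "?m F z j i = ?m z F j i" by simp
  qed
  then obtain c where c: "\<And>i j. i \<in> I \<Longrightarrow> j \<in> I \<Longrightarrow> z i j = (if i = j then c else 0)"
    using F by (auto simp: frobenius_form_def scalar_on_def)
  have zc: "z i j = c * identity_on I i j" for i j
    using c[of i j] pattern_algebra_zero[OF zA, of i j]
    by (cases "i \<in> I"; cases "j \<in> I") (auto simp: identity_on_def)
  have "x i j = (if i = j then c else 0)" if ij: "i \<in> I" "j \<in> I" for i j
  proof -
    have "?m (?m G z) H = ?m (?m G H) (?m x (?m G H))"
      by (simp add: assoc z_def)
    then have "?m (?m G z) H i j = x i j"
      using GH ij by (simp add: mprod_identity[OF fin])
    moreover have "?m G z a b = c * G a b" if "b \<in> I" for a b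
    proof -
      have "?m G z a b = c * ?m G (identity_on I) a b"
        by (simp add: mprod_def zc sum_distrib_left algebra_simps)
      then show ?thesis using that by (simp add: mprod_identity[OF fin])
    qed
    then have "?m (?m G z) H i j = ?m (\<lambda>a b. c * G a b) H i j"
      by (intro mprod_cong) auto
    moreover have "\<dots> = c * ?m G H i j"
      by (simp add: mprod_def sum_distrib_left algebra_simps)
    ultimately show ?thesis using GH ij by (auto simp: identity_on_def split: if_splits)
  qed
  then show "scalar_on I x" by (auto simp: scalar_on_def)
qed

text \<open>The identity matrix with column \<open>c\<close> replaced by \<open>u\<close>. Conjugation by one such matrix clears a
  whole column or a whole row in a single step.\<close>

definition column_replacement :: "'i set \<Rightarrow> 'i \<Rightarrow> ('i \<Rightarrow> 'k::field) \<Rightarrow> 'i \<Rightarrow> 'i \<Rightarrow> 'k" where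
  "column_replacement I c u r s = (if s = c then u r else identity_on I r s)"

lemma mprod_column_replacement_right:
  assumes "finite I" "s \<in> I"
  shows "mprod I x (column_replacement I c u) r s = (if s = c then \<Sum>k\<in>I. x r k * u k else x r s)"
proof (cases "s = c")
  case True then show ?thesis by (simp add: mprod_def column_replacement_def)
next
  case False
  then have "mprod I x (column_replacement I c u) r s = mprod I x (identity_on I) r s"
    by (simp add: mprod_def column_replacement_def)
  then show ?thesis using False assms by (simp add: mprod_identity)
qed

lemma mprod_column_replacement_left:
  assumes "finite I" "r \<in> I" "c \<in> I"
  shows "mprod I (column_replacement I c u) x r s = (if r = c then 0 else x r s) + u r * x c s"
proof -
  have "mprod I (column_replacement I c u) x r s = u r * x c s + (\<Sum>k\<in>I - {c}. identity_on I r k * x k s)"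
    using assms by (simp add: mprod_def column_replacement_def sum.remove[of I c])
  also have "(\<Sum>k\<in>I - {c}. identity_on I r k * x k s) = (\<Sum>k\<in>I - {c}. if k = r then x r s else 0)"
    using assms by (intro sum.cong) (auto simp: identity_on_def)
  also have "\<dots> = (if r = c then 0 else x r s)"
    using assms by (simp add: sum.delta)
  finally show ?thesis by simp
qed

lemma column_replacement_in_pattern_algebra:
  assumes "\<And>i. i \<in> I \<Longrightarrow> R i i" "c \<in> I" "\<And>r. u r \<noteq> 0 \<Longrightarrow> r \<in> I \<and> R r c"
  shows "column_replacement I c u \<in> pattern_algebra I R"
  using assms by (auto simp: pattern_algebra_def column_replacement_def identity_on_def split: if_splits)

lemma column_replacement_inverse:
  assumes "finite I" "c \<in> I" "\<And>r. r \<notin> I \<Longrightarrow> u r = 0 \<and> u' r = 0" and "u c * u' c = 1"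
    and "\<And>r. r \<in> I \<Longrightarrow> r \<noteq> c \<Longrightarrow> u' r + u r * u' c = 0"
  shows "mprod I (column_replacement I c u) (column_replacement I c u') = identity_on I"
proof (intro ext)
  fix r s
  show "mprod I (column_replacement I c u) (column_replacement I c u') r s = identity_on I r s"
  proof (cases "r \<in> I")
    case True
    then show ?thesis using assms
      by (auto simp: mprod_column_replacement_left column_replacement_def identity_on_def)
  next
    case False
    then show ?thesis using assms
      by (auto simp: mprod_def column_replacement_def identity_on_def intro!: sum.neutral)
  qed
qed

text \<open>Multiplication by the matrix on the right replaces column \<open>c\<close> of \<open>F\<close> by the combination of
  columns with coefficients \<open>u\<close>; multiplication by its inverse on the left subtracts multiples of row
  \<open>c\<close> from the other rows and rescales row \<open>c\<close>. In the two applications below, only one of the two effects is visible in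
  the entries under consideration.\<close>

lemma frobenius_form_column_operation:
  fixes F :: "'i \<Rightarrow> 'i \<Rightarrow> 'k::field"
  assumes fin: "finite I" and c: "c \<in> I"
    and refl: "\<And>i. i \<in> I \<Longrightarrow> R i i"
    and trans: "\<And>i j k. i \<in> I \<Longrightarrow> j \<in> I \<Longrightarrow> k \<in> I \<Longrightarrow> R i j \<Longrightarrow> R j k \<Longrightarrow> R i k"
    and u: "\<And>r. u r \<noteq> 0 \<Longrightarrow> r \<in> I \<and> R r c" and uc: "u c \<noteq> 0"
    and F: "frobenius_form I R F"
  obtains F' where "frobenius_form I R F'"
    "\<And>r s. r \<in> I \<Longrightarrow> s \<in> I \<Longrightarrow>
      F' r s = (let X = \<lambda>r. if s = c then \<Sum>k\<in>I. F r k * u k else F r s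
                in (if r = c then 0 else X r) + (if r = c then 1 / u c else - u r / u c) * X c)"
proof -
  define u' where "u' = (\<lambda>r. if r = c then 1 / u c else - u r / u c)"
  define F' where "F' = mprod I (column_replacement I c u') (mprod I F (column_replacement I c u))"
  have u0: "u r = 0 \<and> u' r = 0" if "r \<notin> I" for r
    using u[of r] that c by (auto simp: u'_def)
  have "frobenius_form I R F'"
    unfolding F'_def
  proof (rule frobenius_form_conj[OF fin _ _ _ _ _ F])
    show "column_replacement I c u \<in> pattern_algebra I R"
      "column_replacement I c u' \<in> pattern_algebra I R"
      using u refl c by (auto intro!: column_replacement_in_pattern_algebra simp: u'_def split: if_splits)
    show "mprod I (column_replacement I c u') (column_replacement I c u) = identity_on I"
      "mprod I (column_replacement I c u) (column_replacement I c u') = identity_on I"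
      using fin c u0 uc by (auto intro!: column_replacement_inverse simp: u'_def field_simps)
  qed (rule trans)
  moreover have "F' r s = (let X = \<lambda>r. if s = c then \<Sum>k\<in>I. F r k * u k else F r s
                in (if r = c then 0 else X r) + (if r = c then 1 / u c else - u r / u c) * X c)"
    if "r \<in> I" "s \<in> I" for r s
    using that fin c by (simp add: F'_def mprod_column_replacement_left mprod_column_replacement_right
        u'_def Let_def)
  ultimately show ?thesis using that by blast
qed

text \<open>In \<open>(F x) j i\<close> a nonzero term \<open>F j k * x k i\<close> has \<open>R k i\<close>, hence \<open>R k j\<close> if \<open>R i j\<close>; so transitivity
  keeps all relevant entries of \<open>F\<close> inside the transposed pattern.\<close>

lemma stabilizer_cong:
  assumes trans: "\<And>i j k. i \<in> I \<Longrightarrow> j \<in> I \<Longrightarrow> k \<in> I \<Longrightarrow> R i j \<Longrightarrow> R j k \<Longrightarrow> R i k"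
    and eq: "\<And>i j. i \<in> I \<Longrightarrow> j \<in> I \<Longrightarrow> R i j \<Longrightarrow> F j i = F' j i"
  shows "stabilizer I R F = stabilizer I R F'"
proof -
  have "mprod I F x j i = mprod I F' x j i" "mprod I x F j i = mprod I x F' j i"
    if x: "x \<in> pattern_algebra I R" and ij: "i \<in> I" "j \<in> I" "R i j" for x i j
  proof -
    have 1: "F j k * x k i = F' j k * x k i" if "k \<in> I" for k
      using eq[of k j] trans[of k i j] ij that pattern_algebraD(3)[OF x, of k i]
      by (cases "x k i = 0") auto
    have 2: "x j k * F k i = x j k * F' k i" if "k \<in> I" for k
      using eq[of i k] trans[of i j k] ij that pattern_algebraD(3)[OF x, of j k]
      by (cases "x j k = 0") auto
    show "mprod I F x j i = mprod I F' x j i" "mprod I x F j i = mprod I x F' j i"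
      unfolding mprod_def by (intro sum.cong HOL.refl 1 2; assumption)+
  qed
  then show ?thesis by (auto simp: stabilizer_def)
qed

lemma frobenius_pattern_iso:
  assumes bij: "bij_betw \<pi> I0 I1"
    and R: "\<And>i j. i \<in> I0 \<Longrightarrow> j \<in> I0 \<Longrightarrow> R0 i j \<longleftrightarrow> R1 (\<pi> i) (\<pi> j)"
    and fr: "frobenius_pattern TYPE('k::field) I1 R1"
  shows "frobenius_pattern TYPE('k) I0 R0"
proof -
  obtain F :: "'b \<Rightarrow> 'b \<Rightarrow> 'k" where F: "frobenius_form I1 R1 F"
    using fr by (auto simp: frobenius_pattern_def)
  define \<psi> where "\<psi> = inv_into I0 \<pi>"
  have \<psi>\<pi>: "\<psi> (\<pi> i) = i" "\<pi> i \<in> I1" if "i \<in> I0" for i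
    using that bij by (auto simp: \<psi>_def bij_betw_def)
  have \<pi>\<psi>: "\<pi> (\<psi> i) = i" "\<psi> i \<in> I0" if "i \<in> I1" for i
    using that bij by (auto simp: \<psi>_def bij_betw_def f_inv_into_f inv_into_into)
  have "frobenius_form I0 R0 (\<lambda>j i. F (\<pi> j) (\<pi> i))"
    unfolding frobenius_form_def
  proof
    fix x assume x: "x \<in> stabilizer I0 R0 (\<lambda>j i. F (\<pi> j) (\<pi> i))"
    define z where "z = (\<lambda>a b. if a \<in> I1 \<and> b \<in> I1 then x (\<psi> a) (\<psi> b) else 0)"
    have m: "mprod I1 F z j i = mprod I0 (\<lambda>j i. F (\<pi> j) (\<pi> i)) x (\<psi> j) (\<psi> i)"
      "mprod I1 z F j i = mprod I0 x (\<lambda>j i. F (\<pi> j) (\<pi> i)) (\<psi> j) (\<psi> i)"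
      if "i \<in> I1" "j \<in> I1" for i j
      unfolding mprod_def sum.reindex_bij_betw[OF bij, symmetric] using that
      by (auto simp: z_def \<psi>\<pi> \<pi>\<psi> intro!: sum.cong)
    have "z \<in> stabilizer I1 R1 F"
      unfolding stabilizer_def
    proof (intro CollectI conjI ballI impI)
      show "z \<in> pattern_algebra I1 R1"
        unfolding pattern_algebra_def
      proof (intro CollectI allI impI)
        fix i j assume "z i j \<noteq> 0"
        then have ij: "i \<in> I1" "j \<in> I1" "x (\<psi> i) (\<psi> j) \<noteq> 0" by (auto simp: z_def split: if_splits)
        then have "R0 (\<psi> i) (\<psi> j)" using x by (auto simp: stabilizer_def pattern_algebra_def)
        then show "i \<in> I1 \<and> j \<in> I1 \<and> R1 i j"
          using R[of "\<psi> i" "\<psi> j"] ij \<pi>\<psi>[of i] \<pi>\<psi>[of j] by simp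
      qed
      fix i j assume "i \<in> I1" "j \<in> I1" "R1 i j"
      then show "mprod I1 F z j i = mprod I1 z F j i"
        using x R[of "\<psi> i" "\<psi> j"] \<pi>\<psi>[of i] \<pi>\<psi>[of j] m[of i j] by (simp add: stabilizer_def)
    qed
    then obtain c where c: "\<And>i j. i \<in> I1 \<Longrightarrow> j \<in> I1 \<Longrightarrow> z i j = (if i = j then c else 0)"
      using F by (auto simp: frobenius_form_def scalar_on_def)
    have "x i j = (if i = j then c else 0)" if "i \<in> I0" "j \<in> I0" for i j
      using c[of "\<pi> i" "\<pi> j"] that \<psi>\<pi> by (auto simp: z_def) (metis \<psi>\<pi>(1))
    then show "scalar_on I0 x" by (auto simp: scalar_on_def)
  qed
  then show ?thesis by (auto simp: frobenius_pattern_def)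
qed

lemma frobenius_pattern_iso_inv:
  assumes bij: "bij_betw \<pi> I0 I1"
    and R: "\<And>i j. i \<in> I0 \<Longrightarrow> j \<in> I0 \<Longrightarrow> R0 i j \<longleftrightarrow> R1 (\<pi> i) (\<pi> j)"
    and fr: "frobenius_pattern TYPE('k::field) I0 R0"
  shows "frobenius_pattern TYPE('k) I1 R1"
proof (rule frobenius_pattern_iso[OF bij_betw_inv_into[OF bij] _ fr])
  fix i j assume "i \<in> I1" "j \<in> I1"
  then show "R1 i j \<longleftrightarrow> R0 (inv_into I0 \<pi> i) (inv_into I0 \<pi> j)"
    using R[of "inv_into I0 \<pi> i" "inv_into I0 \<pi> j"] bij
    by (simp add: bij_betw_def f_inv_into_f inv_into_into)
qed

lemma frobenius_pattern_cong:
  assumes "\<And>i j. i \<in> I \<Longrightarrow> j \<in> I \<Longrightarrow> R i j \<longleftrightarrow> R' i j"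
  shows "frobenius_pattern TYPE('k::field) I R \<longleftrightarrow> frobenius_pattern TYPE('k) I R'"
  using frobenius_pattern_iso[of "\<lambda>i. i" I I] assms by (auto simp: bij_betw_def)

text \<open>Transposition is an anti-automorphism, which changes the sign of the commutator only.\<close>

lemma frobenius_pattern_transpose:
  assumes "frobenius_pattern TYPE('k::field) I R"
  shows "frobenius_pattern TYPE('k) I (\<lambda>i j. R j i)"
proof -
  obtain F :: "'a \<Rightarrow> 'a \<Rightarrow> 'k" where F: "frobenius_form I R F"
    using assms by (auto simp: frobenius_pattern_def)
  have "frobenius_form I (\<lambda>i j. R j i) (\<lambda>j i. F i j)"
    unfolding frobenius_form_def
  proof
    fix x assume x: "x \<in> stabilizer I (\<lambda>i j. R j i) (\<lambda>j i. F i j)"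
    then have "(\<lambda>i j. x j i) \<in> stabilizer I R F"
      by (auto simp: stabilizer_def pattern_algebra_def mprod_def mult.commute)
    then show "scalar_on I x"
      using F by (fastforce simp: frobenius_form_def scalar_on_def)
  qed
  then show ?thesis by (auto simp: frobenius_pattern_def)
qed

section \<open>Normalising the corner of a form\<close>

text \<open>The part of \<open>F\<close> with rows \<open>T\<close> and columns \<open>W\<close> is a partial permutation matrix.\<close>

definition partial_matching :: "'i set \<Rightarrow> 'i set \<Rightarrow> ('i \<Rightarrow> 'i \<Rightarrow> 'k::field) \<Rightarrow> bool" where
  "partial_matching T W F \<longleftrightarrow>
     (\<forall>a\<in>T. \<forall>w\<in>W. F a w = 0 \<or> F a w = 1) \<and>
     (\<forall>a\<in>T. \<forall>b\<in>T. \<forall>w\<in>W. F a w \<noteq> 0 \<longrightarrow> F b w \<noteq> 0 \<longrightarrow> a = b) \<and>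
     (\<forall>a\<in>T. \<forall>v\<in>W. \<forall>w\<in>W. F a v \<noteq> 0 \<longrightarrow> F a w \<noteq> 0 \<longrightarrow> v = w)"

text \<open>The pattern has a full block at \<open>T\<close>, an arbitrary pattern at \<open>J\<close>, and between the two precisely the
  corner \<open>V \<times> T\<close>. On \<open>V\<close> the pattern contains the lower triangle, which makes column operations
  from later to earlier columns available.\<close>

locale block_extension =
  fixes T J V :: "'i::linorder set" and R :: "'i \<Rightarrow> 'i \<Rightarrow> bool"
  assumes finite_T: "finite T" and finite_J: "finite J"
    and T_nonempty: "T \<noteq> {}" and disjoint: "T \<inter> J = {}" and V_subset: "V \<subseteq> J"
    and R_refl: "i \<in> T \<union> J \<Longrightarrow> R i i"
    and R_trans: "i \<in> T \<union> J \<Longrightarrow> j \<in> T \<union> J \<Longrightarrow> k \<in> T \<union> J \<Longrightarrow> R i j \<Longrightarrow> R j k \<Longrightarrow> R i k"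
    and T_clique: "i \<in> T \<Longrightarrow> j \<in> T \<Longrightarrow> R i j"
    and not_T_J: "i \<in> T \<Longrightarrow> j \<in> J \<Longrightarrow> \<not> R i j"
    and J_T_iff: "i \<in> J \<Longrightarrow> j \<in> T \<Longrightarrow> R i j \<longleftrightarrow> i \<in> V"
    and V_lower: "i \<in> V \<Longrightarrow> j \<in> V \<Longrightarrow> j \<le> i \<Longrightarrow> R i j"
begin

abbreviation I where "I \<equiv> T \<union> J"

lemma finite_I: "finite I" and finite_V: "finite V"
  using finite_T finite_J V_subset finite_subset by auto

text \<open>The corner \<open>V \<times> T\<close> is a bimodule, so its row set \<open>V\<close> is stable under the algebra at \<open>J\<close>.\<close>

lemma V_closed:
  assumes "i \<in> J" "j \<in> V" "R i j"
  shows "i \<in> V"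
proof -
  obtain t where t: "t \<in> T" using T_nonempty by blast
  then have "R j t" using J_T_iff assms V_subset by auto
  then have "R i t" using R_trans[of i j t] assms t V_subset by auto
  then show ?thesis using J_T_iff assms t by simp
qed

lemma sum_I: "sum f I = sum f T + sum f J"
  using finite_T finite_J disjoint by (rule sum.union_disjoint)

lemma column_operation:
  fixes F :: "'i \<Rightarrow> 'i \<Rightarrow> 'k::field"
  assumes F: "frobenius_form I R F" and c: "c \<in> I"
    and u: "\<forall>r. u r \<noteq> 0 \<longrightarrow> r \<in> I \<and> R r c" and uc: "u c \<noteq> 0"
  obtains F' where "frobenius_form I R F'"
    "\<And>r s. r \<in> I \<Longrightarrow> s \<in> I \<Longrightarrow>
      F' r s = (let X = \<lambda>r. if s = c then \<Sum>k\<in>I. F r k * u k else F r s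
                in (if r = c then 0 else X r) + (if r = c then 1 / u c else - u r / u c) * X c)"
proof (rule frobenius_form_column_operation[of I c R u F])
  show "R i k" if "i \<in> I" "j \<in> I" "k \<in> I" "R i j" "R j k" for i j k
    by (rule R_trans[OF that])
qed (use assms finite_I R_refl in auto)

text \<open>One step of an echelon algorithm that treats the columns from the last to the first. Adding
  multiples of the treated columns clears the new column \<open>j\<close> in all rows that are already
  matched; if an entry remains, it becomes a pivot and row operations clear the rest of the column,
  which leaves the treated columns unchanged because they vanish in the pivot row.\<close>

lemma partial_matching_extend:
  fixes F :: "'i \<Rightarrow> 'i \<Rightarrow> 'k::field"
  assumes W: "W \<subseteq> V" and j: "j \<in> V" and less: "\<And>w. w \<in> W \<Longrightarrow> j < w"
    and F: "frobenius_form I R F" and match: "partial_matching T W F"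
  shows "\<exists>F' :: 'i \<Rightarrow> 'i \<Rightarrow> 'k. frobenius_form I R F' \<and> partial_matching T (insert j W) F'"
proof -
  have jI: "j \<in> I" and jT: "j \<notin> T" and jW: "j \<notin> W"
    using j less V_subset disjoint by auto
  have finW: "finite W" using W finite_V finite_subset by blast
  have WT: "w \<in> W \<Longrightarrow> w \<notin> T" for w using W V_subset disjoint by auto
  have WI: "W \<subseteq> I" using W V_subset by auto
  \<comment> \<open>The coefficient at \<open>w\<close> is minus the entry of column \<open>j\<close> in the row matched with \<open>w\<close>: at most
    one summand is nonzero.\<close>
  define u where "u = (\<lambda>r. if r = j then 1 else if r \<in> W then - (\<Sum>b\<in>T. F b r * F b j) else (0::'k))"
  have u: "r \<in> I \<and> R r j" if "u r \<noteq> 0" for r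
    using that less[of r] W j V_subset V_lower[of r j] R_refl[OF jI]
    by (auto simp: u_def jI split: if_splits)
  have uj: "u j \<noteq> 0" by (simp add: u_def)
  obtain F1 where F1: "frobenius_form I R F1"
    and F1_eq: "\<And>r s. r \<in> I \<Longrightarrow> s \<in> I \<Longrightarrow>
      F1 r s = (let X = \<lambda>r. if s = j then \<Sum>k\<in>I. F r k * u k else F r s
                in (if r = j then 0 else X r) + (if r = j then 1 / u j else - u r / u j) * X j)"
    using column_operation[of F j u] F jI u uj by blast
  have F1_W: "F1 a w = F a w" if "a \<in> T" "w \<in> W" for a w
  proof -
    have "a \<noteq> j" "w \<noteq> j" "a \<in> I" "w \<in> I" "u a = 0"
      using that jT jW WI WT[of a] by (auto simp: u_def)
    then show ?thesis using F1_eq[of a w] by (simp add: Let_def)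
  qed
  have F1_j: "F1 a j = (\<Sum>k\<in>I. F a k * u k)" if "a \<in> T" for a
  proof -
    have "a \<noteq> j" "a \<in> I" "u a = 0"
      using that jT WT[of a] by (auto simp: u_def)
    then show ?thesis using F1_eq[of a j] jI by (simp add: Let_def)
  qed
  have F1_j': "F1 a j = F a j - (\<Sum>w\<in>W. F a w * (\<Sum>b\<in>T. F b w * F b j))" if "a \<in> T" for a
  proof -
    have "(\<Sum>k\<in>I. F a k * u k) = (\<Sum>k\<in>insert j W. F a k * u k)"
      using finite_I WI jI by (intro sum.mono_neutral_right) (auto simp: u_def)
    also have "\<dots> = F a j + (\<Sum>w\<in>W. F a w * u w)"
      using finW jW by (simp add: u_def)
    also have "(\<Sum>w\<in>W. F a w * u w) = - (\<Sum>w\<in>W. F a w * (\<Sum>b\<in>T. F b w * F b j))"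
      unfolding sum_negf[symmetric] using jW by (intro sum.cong) (auto simp: u_def)
    finally show ?thesis using F1_j[OF that] by simp
  qed
  have cleared: "F1 a j = 0" if a: "a \<in> T" and w: "w \<in> W" "F a w \<noteq> 0" for a w
  proof -
    have aw: "F a w = 1" using match a w by (auto simp: partial_matching_def)
    have zero1: "F a v = 0" if "v \<in> W" "v \<noteq> w" for v
      using match a w that unfolding partial_matching_def by blast
    have zero2: "F b w = 0" if "b \<in> T" "b \<noteq> a" for b
      using match a w that unfolding partial_matching_def by blast
    have "(\<Sum>v\<in>W. F a v * (\<Sum>b\<in>T. F b v * F b j)) = F a w * (\<Sum>b\<in>T. F b w * F b j)"
      using finW w zero1 by (subst sum.remove[of _ w]) auto
    also have "(\<Sum>b\<in>T. F b w * F b j) = F a w * F a j"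
      using finite_T a zero2 by (subst sum.remove[of _ a]) auto
    finally show ?thesis using F1_j'[OF a] aw by simp
  qed
  show ?thesis
  proof (cases "\<forall>a\<in>T. F1 a j = 0")
    case True
    then have "partial_matching T (insert j W) F1"
      using match F1_W by (auto simp: partial_matching_def)
    then show ?thesis using F1 by blast
  next
    case False
    then obtain c where c: "c \<in> T" "F1 c j \<noteq> 0" by blast
    have c0: "F1 c w = 0" if "w \<in> W" for w
      using cleared[of c w] c F1_W that by auto
    \<comment> \<open>A column operation at the pivot row \<open>c\<close>, which acts on the columns of \<open>V\<close> through its row part.\<close>
    define u2 where "u2 = (\<lambda>r. if r \<in> T then F1 r j else 0)"
    have u2: "r \<in> I \<and> R r c" if "u2 r \<noteq> 0" for r
      using that T_clique c by (auto simp: u2_def split: if_splits)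
    have u2c: "u2 c \<noteq> 0" using c by (simp add: u2_def)
    have cI: "c \<in> I" using c by simp
    obtain F2 where F2: "frobenius_form I R F2"
      and F2_eq: "\<And>r s. r \<in> I \<Longrightarrow> s \<in> I \<Longrightarrow>
        F2 r s = (let X = \<lambda>r. if s = c then \<Sum>k\<in>I. F1 r k * u2 k else F1 r s
                in (if r = c then 0 else X r) + (if r = c then 1 / u2 c else - u2 r / u2 c) * X c)"
      using column_operation[of F1 c u2] F1 cI u2 u2c by blast
    have F2_W: "F2 a w = F a w" if "a \<in> T" "w \<in> W" for a w
    proof -
      have "w \<noteq> c" "a \<in> I" "w \<in> I" using WT c that WI by auto
      then show ?thesis
        using F2_eq[of a w] c0[of w] F1_W[of c w] F1_W[OF that] that c by (auto simp: Let_def)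
    qed
    have F2_j: "F2 a j = (if a = c then 1 else 0)" if "a \<in> T" for a
      using F2_eq[of a j] that c jT jI by (auto simp: Let_def u2_def)
    have "partial_matching T (insert j W) F2"
      using match F2_W F2_j c0 F1_W c jW unfolding partial_matching_def by auto
    then show ?thesis using F2 by blast
  qed
qed

lemma exists_matched_form:
  fixes F :: "'i \<Rightarrow> 'i \<Rightarrow> 'k::field"
  assumes "frobenius_form I R F"
  shows "\<exists>F' :: 'i \<Rightarrow> 'i \<Rightarrow> 'k. frobenius_form I R F' \<and> partial_matching T V F'"
proof -
  have "W \<subseteq> V \<Longrightarrow> (\<forall>v\<in>V. \<forall>w\<in>W. w \<le> v \<longrightarrow> v \<in> W) \<Longrightarrow>
      \<exists>F' :: 'i \<Rightarrow> 'i \<Rightarrow> 'k. frobenius_form I R F' \<and> partial_matching T W F'" if "finite W" for W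
    using that
  proof (induction W rule: finite_linorder_min_induct)
    case empty
    then show ?case using assms by (auto simp: partial_matching_def)
  next
    case (insert b A)
    have "\<forall>v\<in>V. \<forall>w\<in>A. w \<le> v \<longrightarrow> v \<in> A"
      using insert.prems insert.hyps by (metis insert_iff leD)
    then obtain F' :: "'i \<Rightarrow> 'i \<Rightarrow> 'k" where "frobenius_form I R F'" "partial_matching T A F'"
      using insert by auto
    then show ?case using partial_matching_extend[of A b F'] insert by auto
  qed
  then show ?thesis using finite_V by auto
qed

text \<open>Otherwise the matrix unit at \<open>(v, t)\<close> would belong to the stabilizer: column \<open>v\<close> of the corner of
  \<open>F\<close> vanishes, and row \<open>t\<close> of it is supported on columns \<open>i\<close> at whose positions \<open>(i, v)\<close> the algebra
  has no entry.\<close>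

lemma unmatched_column:
  fixes F :: "'i \<Rightarrow> 'i \<Rightarrow> 'k::field"
  assumes F: "frobenius_form I R F" and v: "v \<in> V" and t: "t \<in> T"
    and zero: "\<And>a. a \<in> T \<Longrightarrow> F a v = 0"
  shows "\<exists>i\<in>V. F t i \<noteq> 0 \<and> R i v"
proof (rule ccontr)
  assume contra: "\<not> ?thesis"
  define x :: "'i \<Rightarrow> 'i \<Rightarrow> 'k" where "x = (\<lambda>i j. if i = v \<and> j = t then 1 else 0)"
  have vI: "v \<in> I" and tI: "t \<in> I" and vt: "v \<noteq> t" using v t V_subset disjoint by auto
  have "x \<in> stabilizer I R F"
    unfolding stabilizer_def
  proof (intro CollectI conjI ballI impI)
    show "x \<in> pattern_algebra I R"
      using J_T_iff v t V_subset by (auto simp: pattern_algebra_def x_def split: if_splits)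
    fix i j assume ij: "i \<in> I" "j \<in> I" "R i j"
    have "mprod I F x j i = (\<Sum>k\<in>I. if k = v then (if i = t then F j v else 0) else 0)"
      unfolding mprod_def by (intro sum.cong) (auto simp: x_def)
    also have "\<dots> = 0"
      using finite_I zero[of j] ij not_T_J[OF t, of j] by auto
    also have "0 = (\<Sum>k\<in>I. if k = t then (if j = v then F t i else 0) else 0)"
      using finite_I contra ij v V_closed[of i v] not_T_J[of i v] V_subset by auto
    also have "\<dots> = mprod I x F j i"
      unfolding mprod_def by (intro sum.cong) (auto simp: x_def)
    finally show "mprod I F x j i = mprod I x F j i" .
  qed
  then have "scalar_on I x" using F by (auto simp: frobenius_form_def)
  then obtain c where "\<forall>i\<in>I. \<forall>j\<in>I. x i j = (if i = j then c else 0)" by (auto simp: scalar_on_def)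
  then have "x v t = 0" using vI tI vt by metis
  then show False by (simp add: x_def)
qed

end

section \<open>Eliminating the matched corner\<close>

lemma sum_restrict:
  assumes "finite B" "A \<subseteq> B"
  shows "(\<Sum>k\<in>B. if k \<in> A then g k else 0) = sum g A"
  using assms by (simp add: sum.inter_restrict[symmetric] Int_absorb1)

text \<open>The combinatorial data left by a corner in normal form: \<open>C\<close> are the matched columns, \<open>T'\<close> the
  unmatched rows, and \<open>\<phi>\<close> sends a matched column to its row. By \<open>unmatched_column\<close> there are not both
  unmatched rows and unmatched columns, and matched columns lie above unmatched ones.\<close>

locale matched_extension = block_extension +
  fixes C T' :: "'a set" and \<phi> :: "'a \<Rightarrow> 'a"
  assumes C_subset: "C \<subseteq> V" and T'_subset: "T' \<subseteq> T"
    and \<phi>_bij: "bij_betw \<phi> (C \<union> T') T" and \<phi>_id: "i \<in> T' \<Longrightarrow> \<phi> i = i"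
    and saturated: "V = C \<or> T' = {}"
    and C_above: "i \<in> C \<Longrightarrow> j \<in> V - C \<Longrightarrow> R i j"
begin

abbreviation Y where "Y \<equiv> C \<union> T'"
abbreviation I' where "I' \<equiv> T' \<union> J"
text \<open>For \<open>T' = {}\<close> this describes the matrices that preserve the kernel of the corner of \<open>F\<close>, which is
  spanned by the unmatched columns; for \<open>V = C\<close> nothing is removed.\<close>

definition R' where "R' i j \<longleftrightarrow> R i j \<and> \<not> (i \<in> C \<and> j \<in> V - C)"

definition matched_form :: "('a \<Rightarrow> 'a \<Rightarrow> 'k::field) \<Rightarrow> bool" where
  "matched_form F \<longleftrightarrow> (\<forall>t\<in>T. \<forall>i\<in>V. F t i = (if i \<in> C \<and> \<phi> i = t then 1 else 0))"

text \<open>The block of \<open>F\<close> at \<open>T\<close> is transported along \<open>\<phi>\<close> and added to the block at \<open>J\<close>, because in the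
  stabilizer the two diagonal blocks are identified along \<open>\<phi>\<close>.\<close>

definition reduced_form :: "('a \<Rightarrow> 'a \<Rightarrow> 'k::field) \<Rightarrow> 'a \<Rightarrow> 'a \<Rightarrow> 'k" where
  "reduced_form F j i = (if j \<in> J \<and> i \<in> J then F j i else 0)
     + (if j \<in> Y \<and> i \<in> Y then F (\<phi> j) (\<phi> i) else 0)"

text \<open>The matrix \<open>y\<close> over the smaller pattern contains the two diagonal blocks of \<open>x\<close>, glued along
  \<open>\<phi>\<close>; of the corner \<open>V \<times> T\<close> of \<open>x\<close> nothing is recorded.\<close>

definition corresponds :: "('a \<Rightarrow> 'a \<Rightarrow> 'k::field) \<Rightarrow> ('a \<Rightarrow> 'a \<Rightarrow> 'k) \<Rightarrow> bool" where
  "corresponds x y \<longleftrightarrow> x \<in> pattern_algebra I R \<and> y \<in> pattern_algebra I' R' \<and>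
     (\<forall>l\<in>Y. \<forall>m\<in>Y. x (\<phi> l) (\<phi> m) = y l m) \<and> (\<forall>l\<in>J. \<forall>m\<in>J. x l m = y l m)"

text \<open>The stabilizer conditions for \<open>x\<close> at the positions of \<open>T \<times> T\<close> and of \<open>J \<times> J\<close>, written in terms of the
  glued matrix \<open>y\<close>. The corner of \<open>x\<close> enters only linearly, through the terms \<open>x l (\<phi> m)\<close>. The
  conditions at the corner itself say that the blocks can be glued.\<close>

definition core_equations :: "('a \<Rightarrow> 'a \<Rightarrow> 'k::field) \<Rightarrow> ('a \<Rightarrow> 'a \<Rightarrow> 'k) \<Rightarrow> ('a \<Rightarrow> 'a \<Rightarrow> 'k) \<Rightarrow> bool" where
  "core_equations F x y \<longleftrightarrow>
    (\<forall>l\<in>Y. \<forall>m\<in>Y. (\<Sum>k\<in>Y. F (\<phi> l) (\<phi> k) * y k m) + (if l \<in> C then x l (\<phi> m) else 0)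
        = (\<Sum>k\<in>Y. y l k * F (\<phi> k) (\<phi> m))) \<and>
    (\<forall>i\<in>J. \<forall>j\<in>J. R i j \<longrightarrow>
       (\<Sum>k\<in>J. F j k * y k i) = (\<Sum>k\<in>J. y j k * F k i) + (if i \<in> C then x j (\<phi> i) else 0))"

text \<open>The result of eliminating the corner of \<open>x\<close> from the previous equations: it is the stabilizer
  condition of \<open>y\<close> for the reduced form.\<close>

definition reduced_equations :: "('a \<Rightarrow> 'a \<Rightarrow> 'k::field) \<Rightarrow> ('a \<Rightarrow> 'a \<Rightarrow> 'k) \<Rightarrow> bool" where
  "reduced_equations F y \<longleftrightarrow>
    (\<forall>l\<in>T'. \<forall>m\<in>Y. (\<Sum>k\<in>Y. F (\<phi> l) (\<phi> k) * y k m) = (\<Sum>k\<in>Y. y l k * F (\<phi> k) (\<phi> m))) \<and>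
    (\<forall>i\<in>J. \<forall>j\<in>J. R' i j \<longrightarrow>
       (\<Sum>k\<in>J. F j k * y k i) + (if j \<in> C then \<Sum>k\<in>Y. F (\<phi> j) (\<phi> k) * y k i else 0)
       = (\<Sum>k\<in>J. y j k * F k i) + (if i \<in> C then \<Sum>k\<in>Y. y j k * F (\<phi> k) (\<phi> i) else 0))"

lemma C_J: "i \<in> C \<Longrightarrow> i \<in> J" "i \<in> C \<Longrightarrow> i \<in> V" "i \<in> C \<Longrightarrow> i \<notin> T"
  and T'_T: "i \<in> T' \<Longrightarrow> i \<in> T" "i \<in> T' \<Longrightarrow> i \<notin> J" "i \<in> T' \<Longrightarrow> i \<notin> V" "i \<in> T' \<Longrightarrow> i \<notin> C"
  using C_subset V_subset T'_subset disjoint by auto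

lemma Y_J: "i \<in> J \<Longrightarrow> i \<in> Y \<longleftrightarrow> i \<in> C" "i \<in> Y \<Longrightarrow> i \<in> I'"
  using C_J T'_T by auto

lemma \<phi>_T: "i \<in> Y \<Longrightarrow> \<phi> i \<in> T"
  using \<phi>_bij by (auto simp: bij_betw_def)

lemma \<phi>_inj: "i \<in> Y \<Longrightarrow> j \<in> Y \<Longrightarrow> \<phi> i = \<phi> j \<longleftrightarrow> i = j"
  using \<phi>_bij by (auto simp: bij_betw_def inj_on_def)

lemma \<phi>_surj: "t \<in> T \<Longrightarrow> \<exists>l\<in>Y. t = \<phi> l"
  using \<phi>_bij by (auto simp: bij_betw_def)

lemma sum_T: "sum f T = (\<Sum>k\<in>Y. f (\<phi> k))"
  using sum.reindex_bij_betw[OF \<phi>_bij, of f] by simp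

lemma finite_Y: "finite Y"
  using C_subset T'_subset finite_V finite_T finite_subset by (metis finite_Un)

text \<open>Three blocks of \<open>y\<close> that the smaller pattern forces to vanish; they account for the boundary terms in
  the elimination.\<close>

lemma corner_zero:
  assumes "y \<in> pattern_algebra I' R'"
  shows "j \<in> J - V \<Longrightarrow> k \<in> Y \<Longrightarrow> y j k = 0"
    and "k \<in> Y \<Longrightarrow> i \<in> V - C \<Longrightarrow> y k i = 0"
    and "k \<in> T' \<Longrightarrow> i \<in> J \<Longrightarrow> y k i = 0"
proof -
  assume "j \<in> J - V" "k \<in> Y"
  then have "\<not> R j k" using V_closed[of j k] J_T_iff[of j k] C_J T'_T by auto
  then show "y j k = 0" using assms by (auto simp: pattern_algebra_def R'_def)
next
  assume "k \<in> Y" "i \<in> V - C"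
  then have "k \<in> C" "\<not> R' k i" using saturated by (auto simp: R'_def)
  then show "y k i = 0" using assms by (auto simp: pattern_algebra_def)
next
  assume "k \<in> T'" "i \<in> J"
  then have "\<not> R k i" using not_T_J T'_T by auto
  then show "y k i = 0" using assms by (auto simp: pattern_algebra_def R'_def)
qed

lemma T_J_zero:
  assumes "x \<in> pattern_algebra I R"
  shows "i \<in> T \<Longrightarrow> j \<in> J \<Longrightarrow> x i j = 0"
    and "i \<in> J - V \<Longrightarrow> j \<in> T \<Longrightarrow> x i j = 0"
    and "i \<in> J - V \<Longrightarrow> j \<in> V \<Longrightarrow> x i j = 0"
  using pattern_algebra_zero[OF assms, of i j] not_T_J[of i j] J_T_iff[of i j] V_closed[of i j] by auto

text \<open>A row of a partial permutation matrix picks out at most one summand.\<close>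

lemma sum_matched_row:
  assumes F: "matched_form F" and l: "l \<in> Y" and f: "\<And>k. k \<in> J - V \<Longrightarrow> f k = 0"
  shows "(\<Sum>k\<in>J. F (\<phi> l) k * f k) = (if l \<in> C then f l else 0)"
proof -
  have "(\<Sum>k\<in>J. F (\<phi> l) k * f k) = (\<Sum>k\<in>J. if k = l then (if l \<in> C then f l else 0) else 0)"
  proof (intro sum.cong refl)
    fix k assume k: "k \<in> J"
    show "F (\<phi> l) k * f k = (if k = l then (if l \<in> C then f l else 0) else 0)"
    proof (cases "k \<in> V")
      case True
      then have "F (\<phi> l) k = (if k \<in> C \<and> \<phi> k = \<phi> l then 1 else 0)"
        using F \<phi>_T[OF l] by (auto simp: matched_form_def)
      then show ?thesis using \<phi>_inj[OF _ l, of k] by auto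
    next
      case False
      then show ?thesis using f k C_J by auto
    qed
  qed
  then show ?thesis using finite_J C_J by auto
qed

lemma sum_matched_column:
  assumes F: "matched_form F" and i: "i \<in> V"
  shows "(\<Sum>k\<in>T. f k * F k i) = (if i \<in> C then f (\<phi> i) else 0)"
proof -
  have "(\<Sum>k\<in>T. f k * F k i) = (\<Sum>k\<in>T. if k = \<phi> i then (if i \<in> C then f (\<phi> i) else 0) else 0)"
    using F i by (intro sum.cong) (auto simp: matched_form_def)
  then show ?thesis using finite_T \<phi>_T[of i] by auto
qed

lemma stabilizer_iff_core:
  assumes F: "matched_form F" and xy: "corresponds x y"
  shows "x \<in> stabilizer I R F \<longleftrightarrow> core_equations F x y"
proof -
  have x: "x \<in> pattern_algebra I R" and y: "y \<in> pattern_algebra I' R'"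
    and xyT: "\<And>l m. l \<in> Y \<Longrightarrow> m \<in> Y \<Longrightarrow> x (\<phi> l) (\<phi> m) = y l m"
    and xyJ: "\<And>l m. l \<in> J \<Longrightarrow> m \<in> J \<Longrightarrow> x l m = y l m"
    using xy by (auto simp: corresponds_def)
  have TT1: "mprod I F x (\<phi> l) (\<phi> m) =
      (\<Sum>k\<in>Y. F (\<phi> l) (\<phi> k) * y k m) + (if l \<in> C then x l (\<phi> m) else 0)"
    if lm: "l \<in> Y" "m \<in> Y" for l m
  proof -
    have "(\<Sum>k\<in>J. F (\<phi> l) k * x k (\<phi> m)) = (if l \<in> C then x l (\<phi> m) else 0)"
      using T_J_zero(2)[OF x _ \<phi>_T[OF lm(2)]] by (intro sum_matched_row F lm)
    moreover have "(\<Sum>k\<in>T. F (\<phi> l) k * x k (\<phi> m)) = (\<Sum>k\<in>Y. F (\<phi> l) (\<phi> k) * y k m)"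
      unfolding sum_T using xyT lm by (intro sum.cong) auto
    ultimately show ?thesis by (simp add: mprod_def sum_I)
  qed
  have TT2: "mprod I x F (\<phi> l) (\<phi> m) = (\<Sum>k\<in>Y. y l k * F (\<phi> k) (\<phi> m))"
    if lm: "l \<in> Y" "m \<in> Y" for l m
  proof -
    have "(\<Sum>k\<in>J. x (\<phi> l) k * F k (\<phi> m)) = 0"
      using T_J_zero(1)[OF x \<phi>_T[OF lm(1)]] by simp
    moreover have "(\<Sum>k\<in>T. x (\<phi> l) k * F k (\<phi> m)) = (\<Sum>k\<in>Y. y l k * F (\<phi> k) (\<phi> m))"
      unfolding sum_T using xyT lm by (intro sum.cong) auto
    ultimately show ?thesis by (simp add: mprod_def sum_I)
  qed
  have JT: "mprod I F x (\<phi> l) i = mprod I x F (\<phi> l) i" if l: "l \<in> Y" and i: "i \<in> V" for l i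
  proof -
    have iJ: "i \<in> J" using i V_subset by auto
    have "mprod I F x (\<phi> l) i = (\<Sum>k\<in>J. F (\<phi> l) k * x k i)"
      using T_J_zero(1)[OF x _ iJ] by (simp add: mprod_def sum_I)
    also have "\<dots> = (if l \<in> C then x l i else 0)"
      using T_J_zero(3)[OF x _ i] by (intro sum_matched_row F l)
    also have "\<dots> = (if l \<in> C then y l i else 0)"
      using xyJ iJ C_J by auto
    also have "\<dots> = (if i \<in> C then y l i else 0)"
      using corner_zero(2)[OF y l, of i] corner_zero(3)[OF y, of l i] l i iJ by auto
    also have "\<dots> = (if i \<in> C then x (\<phi> l) (\<phi> i) else 0)"
      using xyT l by auto
    also have "\<dots> = (\<Sum>k\<in>T. x (\<phi> l) k * F k i)"
      using sum_matched_column[OF F i] by simp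
    also have "\<dots> = mprod I x F (\<phi> l) i"
      using T_J_zero(1)[OF x \<phi>_T[OF l]] by (simp add: mprod_def sum_I)
    finally show ?thesis .
  qed
  have JJ1: "mprod I F x j i = (\<Sum>k\<in>J. F j k * y k i)" if "i \<in> J" "j \<in> J" for i j
    using T_J_zero(1)[OF x _ that(1)] xyJ that by (simp add: mprod_def sum_I)
  have JJ2: "mprod I x F j i = (\<Sum>k\<in>J. y j k * F k i) + (if i \<in> C then x j (\<phi> i) else 0)"
    if "i \<in> J" "j \<in> J" "R i j" for i j
  proof -
    have "(\<Sum>k\<in>T. x j k * F k i) = (if i \<in> C then x j (\<phi> i) else 0)"
    proof (cases "i \<in> V")
      case True then show ?thesis by (rule sum_matched_column[OF F])
    next
      case False
      then have "j \<notin> V" using V_closed[of i j] that False by auto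
      then show ?thesis using T_J_zero(2)[OF x, of j] that False C_J by auto
    qed
    then show ?thesis using xyJ that by (simp add: mprod_def sum_I)
  qed
  show ?thesis
  proof
    assume st: "x \<in> stabilizer I R F"
    have eq: "mprod I F x j i = mprod I x F j i" if "i \<in> I" "j \<in> I" "R i j" for i j
      using st that by (auto simp: stabilizer_def)
    show "core_equations F x y"
      unfolding core_equations_def
    proof (intro conjI ballI impI)
      fix l m assume lm: "l \<in> Y" "m \<in> Y"
      then have "mprod I F x (\<phi> l) (\<phi> m) = mprod I x F (\<phi> l) (\<phi> m)"
        using \<phi>_T T_clique by (intro eq) auto
      then show "(\<Sum>k\<in>Y. F (\<phi> l) (\<phi> k) * y k m) + (if l \<in> C then x l (\<phi> m) else 0)
        = (\<Sum>k\<in>Y. y l k * F (\<phi> k) (\<phi> m))"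
        using TT1[OF lm] TT2[OF lm] by simp
    next
      fix i j assume ij: "i \<in> J" "j \<in> J" "R i j"
      then show "(\<Sum>k\<in>J. F j k * y k i) = (\<Sum>k\<in>J. y j k * F k i) + (if i \<in> C then x j (\<phi> i) else 0)"
        using eq[of i j] JJ1[OF ij(1,2)] JJ2[OF ij] by simp
    qed
  next
    assume ce: "core_equations F x y"
    show "x \<in> stabilizer I R F"
      unfolding stabilizer_def
    proof (intro CollectI conjI x ballI impI)
      fix i j assume ij: "i \<in> I" "j \<in> I" "R i j"
      show "mprod I F x j i = mprod I x F j i"
      proof (cases "j \<in> T")
        case jT: True
        then obtain l where l: "l \<in> Y" "j = \<phi> l" using \<phi>_surj by blast
        show ?thesis
        proof (cases "i \<in> T")
          case True
          then obtain m where m: "m \<in> Y" "i = \<phi> m" using \<phi>_surj by blast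
          show ?thesis using ce l m TT1 TT2 by (simp add: core_equations_def)
        next
          case False
          then have "i \<in> V" using J_T_iff ij jT by auto
          then show ?thesis using JT l by simp
        qed
      next
        case False
        then have "j \<in> J" "i \<in> J" using ij not_T_J by auto
        then show ?thesis using ce ij JJ1 JJ2 by (simp add: core_equations_def)
      qed
    qed
  qed
qed

lemma stabilizer_iff_reduced:
  assumes y: "y \<in> pattern_algebra I' R'"
  shows "y \<in> stabilizer I' R' (reduced_form F) \<longleftrightarrow> reduced_equations F y"
proof -
  have finI': "finite I'" using finite_J finite_subset[OF T'_subset finite_T] by simp
  have subJ: "J \<subseteq> I'" and subY: "Y \<subseteq> I'" using C_J by auto
  have L: "mprod I' (reduced_form F) y j i =
      (if j \<in> J then \<Sum>k\<in>J. F j k * y k i else 0) + (if j \<in> Y then \<Sum>k\<in>Y. F (\<phi> j) (\<phi> k) * y k i else 0)"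
    for j i
  proof -
    have "mprod I' (reduced_form F) y j i =
       (\<Sum>k\<in>I'. (if k \<in> J then (if j \<in> J then F j k * y k i else 0) else 0)) +
       (\<Sum>k\<in>I'. (if k \<in> Y then (if j \<in> Y then F (\<phi> j) (\<phi> k) * y k i else 0) else 0))"
      unfolding mprod_def sum.distrib[symmetric]
      by (intro sum.cong refl) (simp add: reduced_form_def algebra_simps)
    also have "\<dots> = (\<Sum>k\<in>J. (if j \<in> J then F j k * y k i else 0)) +
       (\<Sum>k\<in>Y. (if j \<in> Y then F (\<phi> j) (\<phi> k) * y k i else 0))"
      unfolding sum_restrict[OF finI' subJ] sum_restrict[OF finI' subY] ..
    finally show ?thesis by simp
  qed
  have Rr: "mprod I' y (reduced_form F) j i =
      (if i \<in> J then \<Sum>k\<in>J. y j k * F k i else 0) + (if i \<in> Y then \<Sum>k\<in>Y. y j k * F (\<phi> k) (\<phi> i) else 0)"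
    for j i
  proof -
    have "mprod I' y (reduced_form F) j i =
       (\<Sum>k\<in>I'. (if k \<in> J then (if i \<in> J then y j k * F k i else 0) else 0)) +
       (\<Sum>k\<in>I'. (if k \<in> Y then (if i \<in> Y then y j k * F (\<phi> k) (\<phi> i) else 0) else 0))"
      unfolding mprod_def sum.distrib[symmetric]
      by (intro sum.cong refl) (simp add: reduced_form_def algebra_simps)
    also have "\<dots> = (\<Sum>k\<in>J. (if i \<in> J then y j k * F k i else 0)) +
       (\<Sum>k\<in>Y. (if i \<in> Y then y j k * F (\<phi> k) (\<phi> i) else 0))"
      unfolding sum_restrict[OF finI' subJ] sum_restrict[OF finI' subY] ..
    finally show ?thesis by simp
  qed
  have T'_row: "(\<Sum>k\<in>J. y l k * F k i) = 0" if "l \<in> T'" for l i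
    using corner_zero(3)[OF y that] by simp
  have T'_pred: "m \<in> Y \<longleftrightarrow> R' m l" if "l \<in> T'" "m \<in> I'" for l m
    using that T_clique[of m l] J_T_iff[of m l] T'_T saturated C_J by (auto simp: R'_def)
  show ?thesis
  proof
    assume st: "y \<in> stabilizer I' R' (reduced_form F)"
    have eq: "mprod I' (reduced_form F) y j i = mprod I' y (reduced_form F) j i"
      if "i \<in> I'" "j \<in> I'" "R' i j" for i j
      using st that by (auto simp: stabilizer_def)
    show "reduced_equations F y"
      unfolding reduced_equations_def
    proof (intro conjI ballI impI)
      fix l m assume lm: "l \<in> T'" "m \<in> Y"
      then have "R' m l" using T'_pred Y_J(2) by blast
      then show "(\<Sum>k\<in>Y. F (\<phi> l) (\<phi> k) * y k m) = (\<Sum>k\<in>Y. y l k * F (\<phi> k) (\<phi> m))"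
        using eq[of m l] L[of l m] Rr[of l m] lm Y_J(2)[of m] T'_T(2)[of l] T'_row[of l m] by simp
    next
      fix i j assume "i \<in> J" "j \<in> J" "R' i j"
      then show "(\<Sum>k\<in>J. F j k * y k i) + (if j \<in> C then \<Sum>k\<in>Y. F (\<phi> j) (\<phi> k) * y k i else 0)
       = (\<Sum>k\<in>J. y j k * F k i) + (if i \<in> C then \<Sum>k\<in>Y. y j k * F (\<phi> k) (\<phi> i) else 0)"
        using eq[of i j] L[of j i] Rr[of j i] Y_J(1)[of i] Y_J(1)[of j] by simp
    qed
  next
    assume re: "reduced_equations F y"
    show "y \<in> stabilizer I' R' (reduced_form F)"
      unfolding stabilizer_def
    proof (intro CollectI conjI y ballI impI)
      fix i j assume ij: "i \<in> I'" "j \<in> I'" "R' i j"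
      show "mprod I' (reduced_form F) y j i = mprod I' y (reduced_form F) j i"
      proof (cases "j \<in> T'")
        case True
        then have "i \<in> Y" using T'_pred ij by blast
        then show ?thesis
          using re True L[of j i] Rr[of j i] T'_T(2)[of j] T'_row[of j i]
          by (simp add: reduced_equations_def)
      next
        case False
        then have "j \<in> J" "i \<in> J" using ij not_T_J T'_T by (auto simp: R'_def)
        then show ?thesis
          using re ij L[of j i] Rr[of j i] Y_J(1)[of i] Y_J(1)[of j]
          by (simp add: reduced_equations_def)
      qed
    qed
  qed
qed

end

context matched_extension
begin

lemma core_equationsD:
  assumes "core_equations F x y"
  shows "l \<in> Y \<Longrightarrow> m \<in> Y \<Longrightarrow>
      (\<Sum>k\<in>Y. F (\<phi> l) (\<phi> k) * y k m) + (if l \<in> C then x l (\<phi> m) else 0)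
        = (\<Sum>k\<in>Y. y l k * F (\<phi> k) (\<phi> m))"
    and "i \<in> J \<Longrightarrow> j \<in> J \<Longrightarrow> R i j \<Longrightarrow>
       (\<Sum>k\<in>J. F j k * y k i) = (\<Sum>k\<in>J. y j k * F k i) + (if i \<in> C then x j (\<phi> i) else 0)"
  using assms unfolding core_equations_def by blast+

text \<open>The corner terms of the two groups of core equations cancel wherever both occur; at all other
  positions of the smaller pattern one of the sums vanishes by \<open>corner_zero\<close>.\<close>

lemma core_imp_reduced:
  assumes xy: "corresponds x y" and ce: "core_equations F x y"
  shows "reduced_equations F y"
  unfolding reduced_equations_def
proof (intro conjI ballI impI)
  fix l m assume "l \<in> T'" "m \<in> Y"
  then show "(\<Sum>k\<in>Y. F (\<phi> l) (\<phi> k) * y k m) = (\<Sum>k\<in>Y. y l k * F (\<phi> k) (\<phi> m))"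
    using core_equationsD(1)[OF ce, of l m] T'_T(4)[of l] by simp
next
  have x: "x \<in> pattern_algebra I R" and y: "y \<in> pattern_algebra I' R'"
    using xy by (auto simp: corresponds_def)
  fix i j assume ij: "i \<in> J" "j \<in> J" "R' i j"
  let ?A = "\<Sum>k\<in>Y. F (\<phi> j) (\<phi> k) * y k i" and ?B = "\<Sum>k\<in>Y. y j k * F (\<phi> k) (\<phi> i)"
  have e: "(\<Sum>k\<in>J. F j k * y k i) = (\<Sum>k\<in>J. y j k * F k i) + (if i \<in> C then x j (\<phi> i) else 0)"
    using core_equationsD(2)[OF ce, of i j] ij by (simp add: R'_def)
  have "(if i \<in> C then x j (\<phi> i) else 0) + (if j \<in> C then ?A else 0) = (if i \<in> C then ?B else 0)"
  proof (cases "j \<in> C")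
    case jC: True
    show ?thesis
    proof (cases "i \<in> C")
      case True
      then show ?thesis using core_equationsD(1)[OF ce, of j i] jC by (simp add: add.commute)
    next
      case False
      then have "i \<in> V - C" using V_closed[of i j] ij jC C_J by (auto simp: R'_def)
      then have "?A = 0" using corner_zero(2)[OF y] by simp
      then show ?thesis using False by simp
    qed
  next
    case jC: False
    show ?thesis
    proof (cases "i \<in> C")
      case True
      then have jV: "j \<in> J - V" using jC ij by (auto simp: R'_def)
      then have "?B = 0" using corner_zero(1)[OF y jV] by simp
      moreover have "x j (\<phi> i) = 0" using T_J_zero(2)[OF x jV] True \<phi>_T by simp
      ultimately show ?thesis using jC by simp
    qed (use jC in simp)
  qed
  then show "(\<Sum>k\<in>J. F j k * y k i) + (if j \<in> C then ?A else 0) = (\<Sum>k\<in>J. y j k * F k i) + (if i \<in> C then ?B else 0)"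
    using e by (simp add: add.assoc)
qed

text \<open>The corner of \<open>x\<close> is recovered from \<open>y\<close>: in the rows of \<open>C\<close> from the equations at \<open>T \<times> T\<close>, and in the
  rows of \<open>V - C\<close> from the equations at the positions that were removed from the pattern.\<close>

lemma reduced_imp_core:
  assumes y: "y \<in> pattern_algebra I' R'" and re: "reduced_equations F y"
  shows "\<exists>x. corresponds x y \<and> core_equations F x y"
proof -
  define \<psi> where "\<psi> = inv_into Y \<phi>"
  have \<psi>: "\<psi> (\<phi> l) = l" if "l \<in> Y" for l
    using that \<phi>_bij by (simp add: \<psi>_def bij_betw_def)
  have TC: "t \<in> T \<Longrightarrow> t \<notin> C \<and> t \<notin> V \<and> t \<notin> J" for t
    using disjoint V_subset C_subset by auto
  define x where "x = (\<lambda>k l.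
    if k \<in> T \<and> l \<in> T then y (\<psi> k) (\<psi> l)
    else if k \<in> J \<and> l \<in> J then y k l
    else if k \<in> C \<and> l \<in> T then
      (\<Sum>n\<in>Y. y k n * F (\<phi> n) l) - (\<Sum>n\<in>Y. F (\<phi> k) (\<phi> n) * y n (\<psi> l))
    else if k \<in> V \<and> l \<in> T then
      (\<Sum>n\<in>J. F k n * y n (\<psi> l)) - (\<Sum>n\<in>J. y k n * F n (\<psi> l))
    else 0)"
  have xT: "x (\<phi> l) (\<phi> m) = y l m" if "l \<in> Y" "m \<in> Y" for l m
    using that \<phi>_T \<psi> by (simp add: x_def)
  have xJ: "x l m = y l m" if "l \<in> J" "m \<in> J" for l m
    using that TC by (auto simp: x_def)
  have xC: "x l (\<phi> m) = (\<Sum>n\<in>Y. y l n * F (\<phi> n) (\<phi> m)) - (\<Sum>n\<in>Y. F (\<phi> l) (\<phi> n) * y n m)"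
    if "l \<in> C" "m \<in> Y" for l m
    using that \<phi>_T[of m] \<psi>[of m] C_J TC[of "\<phi> m"] by (simp add: x_def)
  have xK: "x l (\<phi> m) = (\<Sum>n\<in>J. F l n * y n m) - (\<Sum>n\<in>J. y l n * F n m)"
    if "l \<in> V - C" "m \<in> Y" for l m
    using that \<phi>_T[of m] \<psi>[of m] TC[of "\<phi> m"] TC[of l] by (auto simp: x_def)
  have x: "x \<in> pattern_algebra I R"
    unfolding pattern_algebra_def
  proof (intro CollectI allI impI)
    fix k l assume nz: "x k l \<noteq> 0"
    show "k \<in> I \<and> l \<in> I \<and> R k l"
    proof (cases "l \<in> T")
      case True
      then have "k \<in> T \<or> k \<in> V" using nz TC C_J by (auto simp: x_def split: if_splits)
      then show ?thesis using True T_clique J_T_iff V_subset by auto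
    next
      case False
      then have "k \<in> J" "l \<in> J" "y k l \<noteq> 0" using nz by (auto simp: x_def split: if_splits)
      then show ?thesis using pattern_algebraD(3)[OF y, of k l] by (auto simp: R'_def)
    qed
  qed
  have c: "corresponds x y" using x y xT xJ by (auto simp: corresponds_def)
  have "core_equations F x y"
    unfolding core_equations_def
  proof (intro conjI ballI impI)
    fix l m assume "l \<in> Y" "m \<in> Y"
    then show "(\<Sum>k\<in>Y. F (\<phi> l) (\<phi> k) * y k m) + (if l \<in> C then x l (\<phi> m) else 0)
        = (\<Sum>k\<in>Y. y l k * F (\<phi> k) (\<phi> m))"
      using xC[of l m] re by (cases "l \<in> C") (auto simp: reduced_equations_def)
  next
    fix i j assume ij: "i \<in> J" "j \<in> J" "R i j"
    show "(\<Sum>k\<in>J. F j k * y k i) = (\<Sum>k\<in>J. y j k * F k i) + (if i \<in> C then x j (\<phi> i) else 0)"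
    proof (cases "R' i j")
      case False
      then have "i \<in> C" "j \<in> V - C" using ij by (auto simp: R'_def)
      then show ?thesis using xK[of j i] by simp
    next
      case True
      let ?A = "\<Sum>k\<in>Y. F (\<phi> j) (\<phi> k) * y k i" and ?B = "\<Sum>k\<in>Y. y j k * F (\<phi> k) (\<phi> i)"
      have e: "(\<Sum>k\<in>J. F j k * y k i) + (if j \<in> C then ?A else 0)
         = (\<Sum>k\<in>J. y j k * F k i) + (if i \<in> C then ?B else 0)"
        using re ij True by (simp add: reduced_equations_def)
      show ?thesis
      proof (cases "j \<in> C")
        case jC: True
        show ?thesis
        proof (cases "i \<in> C")
          case True
          then have "(\<Sum>k\<in>J. F j k * y k i) = (\<Sum>k\<in>J. y j k * F k i) + ?B - ?A"
            using e jC by (simp add: eq_diff_eq)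
          then show ?thesis using xC[of j i] jC True by (simp add: add_diff_eq)
        next
          case False
          then have "i \<in> V - C" using V_closed[of i j] ij jC C_J by auto
          then have "?A = 0" using corner_zero(2)[OF y] by simp
          then show ?thesis using False e jC by simp
        qed
      next
        case jC: False
        show ?thesis
        proof (cases "i \<in> C")
          case iC: True
          then have jV: "j \<in> J - V" using jC ij True by (auto simp: R'_def)
          then have "?B = 0" using corner_zero(1)[OF y jV] by simp
          moreover have "x j (\<phi> i) = 0" using T_J_zero(2)[OF x jV] iC \<phi>_T by simp
          ultimately show ?thesis using jC e iC by simp
        qed (use jC e in simp)
      qed
    qed
  qed
  then show ?thesis using c by blast
qed

text \<open>The stabilizer condition at the corner positions says that the block at \<open>T\<close> agrees with the
  block at \<open>C\<close> under \<open>\<phi>\<close>, and that unmatched columns receive nothing from matched ones.\<close>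

lemma stabilizer_corresponds:
  assumes F: "matched_form F" and st: "x \<in> stabilizer I R F"
  shows "\<exists>y. corresponds x y"
proof -
  have x: "x \<in> pattern_algebra I R" using st by (simp add: stabilizer_def)
  \<comment> \<open>Both sides are values of the two products at the corner position \<open>(i, \<phi> l)\<close>.\<close>
  have link: "(if l \<in> C then x l i else 0) = (if i \<in> C then x (\<phi> l) (\<phi> i) else 0)"
    if l: "l \<in> Y" and i: "i \<in> V" for l i
  proof -
    have iJ: "i \<in> J" using i V_subset by auto
    have "mprod I F x (\<phi> l) i = (\<Sum>k\<in>J. F (\<phi> l) k * x k i)"
      using T_J_zero(1)[OF x _ iJ] by (simp add: mprod_def sum_I)
    also have "\<dots> = (if l \<in> C then x l i else 0)"
      using T_J_zero(3)[OF x _ i] by (intro sum_matched_row F l)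
    finally have 1: "mprod I F x (\<phi> l) i = (if l \<in> C then x l i else 0)" .
    have "mprod I x F (\<phi> l) i = (\<Sum>k\<in>T. x (\<phi> l) k * F k i)"
      using T_J_zero(1)[OF x \<phi>_T[OF l]] by (simp add: mprod_def sum_I)
    also have "\<dots> = (if i \<in> C then x (\<phi> l) (\<phi> i) else 0)"
      using sum_matched_column[OF F i] by simp
    finally have 2: "mprod I x F (\<phi> l) i = (if i \<in> C then x (\<phi> l) (\<phi> i) else 0)" .
    have "R i (\<phi> l)" using J_T_iff[OF iJ \<phi>_T[OF l]] i by simp
    then show ?thesis using st 1 2 \<phi>_T[OF l] iJ by (auto simp: stabilizer_def)
  qed
  define y where "y = (\<lambda>l m. if l \<in> Y \<and> m \<in> Y then x (\<phi> l) (\<phi> m)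
     else if l \<in> J \<and> m \<in> J then x l m else 0)"
  have yJ: "y l m = x l m" if "l \<in> J" "m \<in> J" for l m
    using that link[of l m] C_J T'_T by (auto simp: y_def)
  have "y \<in> pattern_algebra I' R'"
    unfolding pattern_algebra_def
  proof (intro CollectI allI impI)
    fix l m assume nz: "y l m \<noteq> 0"
    show "l \<in> I' \<and> m \<in> I' \<and> R' l m"
    proof (cases "l \<in> J \<and> m \<in> J")
      case True
      then have "R l m" using nz yJ[of l m] pattern_algebraD(3)[OF x, of l m] by simp
      moreover have "\<not> (l \<in> C \<and> m \<in> V - C)"
        using nz yJ[of l m] True link[of l m] by (auto split: if_splits)
      ultimately show ?thesis using True by (simp add: R'_def)
    next
      case False
      then have lm: "l \<in> Y" "m \<in> Y" "l \<in> T' \<or> m \<in> T'" "x (\<phi> l) (\<phi> m) \<noteq> 0"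
        using nz C_J by (auto simp: y_def split: if_splits)
      then have "m \<in> T'" using link[of l m] C_J T'_T by auto
      then have "R l m" using lm T_clique[of l m] J_T_iff[of l m] T'_T C_J by auto
      then show ?thesis using lm \<open>m \<in> T'\<close> T'_T Y_J(2) by (auto simp: R'_def)
    qed
  qed
  then have "corresponds x y" using x yJ by (auto simp: corresponds_def y_def)
  then show ?thesis by blast
qed

text \<open>Corresponding elements are scalar at the same time: the corner of \<open>x\<close> is determined by linear
  equations which, for scalar diagonal blocks, force it to vanish.\<close>

lemma frobenius_form_iff_reduced:
  fixes F :: "'a \<Rightarrow> 'a \<Rightarrow> 'k::field"
  assumes F: "matched_form F"
  shows "frobenius_form I R F \<longleftrightarrow> frobenius_form I' R' (reduced_form F)"
proof
  assume fr: "frobenius_form I R F"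
  show "frobenius_form I' R' (reduced_form F)"
    unfolding frobenius_form_def
  proof
    fix y assume st: "y \<in> stabilizer I' R' (reduced_form F)"
    then have y: "y \<in> pattern_algebra I' R'" by (simp add: stabilizer_def)
    obtain x where x: "corresponds x y" "core_equations F x y"
      using reduced_imp_core[OF y] stabilizer_iff_reduced[OF y] st by blast
    then have "scalar_on I x" using stabilizer_iff_core[OF F] fr by (auto simp: frobenius_form_def)
    then obtain c where c: "\<And>i j. i \<in> I \<Longrightarrow> j \<in> I \<Longrightarrow> x i j = (if i = j then c else 0)"
      by (auto simp: scalar_on_def)
    have "y l m = (if l = m then c else 0)" if lm: "l \<in> I'" "m \<in> I'" for l m
    proof (cases "(l \<in> J \<and> m \<in> J) \<or> (l \<in> Y \<and> m \<in> Y)")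
      case True
      then show ?thesis
      proof
        assume "l \<in> J \<and> m \<in> J"
        then show ?thesis using x(1) c[of l m] by (auto simp: corresponds_def)
      next
        assume *: "l \<in> Y \<and> m \<in> Y"
        then have "y l m = x (\<phi> l) (\<phi> m)" using x(1) by (auto simp: corresponds_def)
        also have "\<dots> = (if \<phi> l = \<phi> m then c else 0)" using * \<phi>_T by (intro c) auto
        finally show ?thesis using * \<phi>_inj[of l m] by simp
      qed
    next
      case False
      then have "l \<noteq> m" using lm by auto
      moreover have "l \<in> T' \<and> m \<in> J \<or> l \<in> J - V \<and> m \<in> Y"
        using False lm saturated by auto
      then have "y l m = 0" using corner_zero(1,3)[OF y] by blast
      ultimately show ?thesis by simp
    qed
    then show "scalar_on I' y" by (auto simp: scalar_on_def)
  qed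
next
  assume fr: "frobenius_form I' R' (reduced_form F)"
  show "frobenius_form I R F"
    unfolding frobenius_form_def
  proof
    fix x assume st: "x \<in> stabilizer I R F"
    then have x: "x \<in> pattern_algebra I R" by (simp add: stabilizer_def)
    obtain y where y: "corresponds x y" using stabilizer_corresponds[OF F st] by blast
    then have yA: "y \<in> pattern_algebra I' R'" by (simp add: corresponds_def)
    have ce: "core_equations F x y" using stabilizer_iff_core[OF F y] st by simp
    then have "scalar_on I' y"
      using core_imp_reduced[OF y] stabilizer_iff_reduced[OF yA] fr by (auto simp: frobenius_form_def)
    then obtain c where c: "\<And>i j. i \<in> I' \<Longrightarrow> j \<in> I' \<Longrightarrow> y i j = (if i = j then c else 0)"
      by (auto simp: scalar_on_def)
    have cJ: "y i j = (if i = j then c else 0)" if "i \<in> J" "j \<in> J" for i j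
      using c that by simp
    have cY: "y i j = (if i = j then c else 0)" if "i \<in> Y" "j \<in> Y" for i j
      using c that Y_J(2) by blast
    have sums: "(\<Sum>k\<in>B. g k * (if k = m then c else 0)) = g m * c"
      "(\<Sum>k\<in>B. (if m = k then c else 0) * g k) = g m * c" if "finite B" "m \<in> B"
      for g :: "'a \<Rightarrow> 'k" and B and m :: 'a
      using that by (simp_all add: if_distrib[of "\<lambda>a. _ * a"] if_distrib[of "\<lambda>a. a * _"] cong: if_cong)
    have corner: "x l (\<phi> m) = 0" if lm: "l \<in> V" "m \<in> Y" for l m
    proof (cases "l \<in> C")
      case True
      have "(\<Sum>k\<in>Y. F (\<phi> l) (\<phi> k) * y k m) = F (\<phi> l) (\<phi> m) * c"
        "(\<Sum>k\<in>Y. y l k * F (\<phi> k) (\<phi> m)) = F (\<phi> l) (\<phi> m) * c"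
        using sums[OF finite_Y] lm True cY by simp_all
      then show ?thesis using core_equationsD(1)[OF ce, of l m] lm True by simp
    next
      case False
      then have mC: "m \<in> C" and lJ: "l \<in> J" and mJ: "m \<in> J" using saturated lm V_subset C_J by auto
      have "(\<Sum>k\<in>J. F l k * y k m) = F l m * c" "(\<Sum>k\<in>J. y l k * F k m) = F l m * c"
        using sums[OF finite_J] lJ mJ cJ by simp_all
      moreover have "R m l" using C_above mC lm False by auto
      ultimately show ?thesis using core_equationsD(2)[OF ce mJ lJ] mC by simp
    qed
    have "x i j = (if i = j then c else 0)" if ij: "i \<in> I" "j \<in> I" for i j
    proof (cases "j \<in> T")
      case True
      then obtain m where m: "m \<in> Y" "j = \<phi> m" using \<phi>_surj by blast
      show ?thesis
      proof (cases "i \<in> T")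
        case True
        then obtain l where l: "l \<in> Y" "i = \<phi> l" using \<phi>_surj by blast
        then have "x i j = y l m" using y m by (auto simp: corresponds_def)
        then show ?thesis using cY[of l m] l m \<phi>_inj by simp
      next
        case False
        then have "x i j = 0"
          using corner[of i m] m ij T_J_zero(2)[OF x, of i j] \<open>j \<in> T\<close> by (cases "i \<in> V") auto
        then show ?thesis using False True by auto
      qed
    next
      case False
      then have jJ: "j \<in> J" using ij by simp
      show ?thesis
      proof (cases "i \<in> T")
        case True
        then show ?thesis using T_J_zero(1)[OF x True jJ] False by auto
      next
        case False
        then have "x i j = y i j" using ij jJ y by (auto simp: corresponds_def)
        then show ?thesis using cJ[of i j] ij jJ False by simp
      qed
    qed
    then show "scalar_on I x" by (auto simp: scalar_on_def)
  qed
qed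

end

context matched_extension
begin

lemma R'_trans:
  assumes "i \<in> I'" "j \<in> I'" "k \<in> I'" "R' i j" "R' j k"
  shows "R' i k"
proof -
  have "R i k" using assms R_trans[of i j k] T'_subset by (auto simp: R'_def)
  moreover have "\<not> (i \<in> C \<and> k \<in> V - C)"
  proof
    assume ik: "i \<in> C \<and> k \<in> V - C"
    have "j \<notin> T" using not_T_J[of j k] assms ik V_subset by (auto simp: R'_def)
    then have "j \<in> J" using assms T'_T by auto
    then have "j \<in> V" using V_closed[of j k] assms ik by (auto simp: R'_def)
    then show False using assms ik by (auto simp: R'_def)
  qed
  ultimately show ?thesis by (simp add: R'_def)
qed

text \<open>Up to irrelevant entries, every form on the smaller pattern algebra is the reduction of a matched
  form; the entries on the rows of \<open>T\<close> matched with \<open>C\<close> may be taken to be zero, since the reduction adds them to the block at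
  \<open>J\<close>.\<close>

lemma frobenius_pattern_extend:
  assumes "frobenius_pattern TYPE('k::field) I' R'"
  shows "frobenius_pattern TYPE('k) I R"
proof -
  obtain G :: "'a \<Rightarrow> 'a \<Rightarrow> 'k" where G: "frobenius_form I' R' G"
    using assms by (auto simp: frobenius_pattern_def)
  define \<psi> where "\<psi> = inv_into Y \<phi>"
  have \<psi>: "\<psi> (\<phi> l) = l" if "l \<in> Y" for l
    using that \<phi>_bij by (simp add: \<psi>_def bij_betw_def)
  define F where "F = (\<lambda>j i.
    if j \<in> T \<and> i \<in> T then (if \<psi> j \<in> T' then G (\<psi> j) (\<psi> i) else 0)
    else if j \<in> T \<and> i \<in> V then (if i \<in> C \<and> \<phi> i = j then 1 else 0)
    else if j \<in> J \<and> i \<in> J then G j i else 0)"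
  have "matched_form F"
    using disjoint V_subset by (auto simp: matched_form_def F_def)
  have FJ: "F j i = G j i" if "j \<in> J" "i \<in> J" for j i
    using that disjoint by (auto simp: F_def)
  have FY: "F (\<phi> j) (\<phi> i) = (if j \<in> T' then G j i else 0)" if "j \<in> Y" "i \<in> Y" for j i
    using that \<phi>_T \<psi> by (simp add: F_def)
  have "reduced_form F j i = G j i" if ij: "i \<in> I'" "j \<in> I'" "R' i j" for i j
  proof (cases "j \<in> T'")
    case True
    then have "i \<in> Y"
      using ij J_T_iff[of i j] T'_T saturated by (auto simp: R'_def)
    then show ?thesis using True FY[of j i] T'_T by (simp add: reduced_form_def)
  next
    case False
    then have "j \<in> J" "i \<in> J" using ij not_T_J T'_T by (auto simp: R'_def)
    then show ?thesis using False FJ FY[of j i] by (auto simp: reduced_form_def)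
  qed
  then have "stabilizer I' R' (reduced_form F) = stabilizer I' R' G"
    using R'_trans by (intro stabilizer_cong) blast+
  then have "frobenius_form I' R' (reduced_form F)" using G by (simp add: frobenius_form_def)
  then show ?thesis
    using frobenius_form_iff_reduced[OF \<open>matched_form F\<close>] by (auto simp: frobenius_pattern_def)
qed

end

text \<open>Normalise the corner of a Frobenius form and read off the matching.\<close>

lemma (in block_extension) frobenius_pattern_reduce:
  assumes "frobenius_pattern TYPE('k::field) I R"
  obtains C T' \<phi> where "matched_extension T J V R C T' \<phi>"
    "frobenius_pattern TYPE('k) (T' \<union> J) (matched_extension.R' V R C)"
proof -
  obtain F0 :: "'i \<Rightarrow> 'i \<Rightarrow> 'k" where F0: "frobenius_form I R F0"
    using assms by (auto simp: frobenius_pattern_def)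
  obtain F :: "'i \<Rightarrow> 'i \<Rightarrow> 'k" where F: "frobenius_form I R F" and match: "partial_matching T V F"
    using exists_matched_form[OF F0] by blast
  have F1: "F a w = 1" if "a \<in> T" "w \<in> V" "F a w \<noteq> 0" for a w
    using match that unfolding partial_matching_def by blast
  have F_row: "a = b" if "a \<in> T" "b \<in> T" "w \<in> V" "F a w \<noteq> 0" "F b w \<noteq> 0" for a b w
    using match that unfolding partial_matching_def by blast
  have F_col: "v = w" if "a \<in> T" "v \<in> V" "w \<in> V" "F a v \<noteq> 0" "F a w \<noteq> 0" for a v w
    using match that unfolding partial_matching_def by blast
  define C where "C = {i \<in> V. \<exists>t\<in>T. F t i \<noteq> 0}"
  define T' where "T' = {t \<in> T. \<forall>i\<in>V. F t i = 0}"
  define \<phi> where "\<phi> = (\<lambda>i. if i \<in> C then (SOME t. t \<in> T \<and> F t i \<noteq> 0) else i)"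
  have \<phi>C: "\<phi> i \<in> T" "F (\<phi> i) i \<noteq> 0" if "i \<in> C" for i
    using someI_ex[of "\<lambda>t. t \<in> T \<and> F t i \<noteq> 0"] that by (auto simp: \<phi>_def C_def)
  have CV: "C \<subseteq> V" and T'T: "T' \<subseteq> T" by (auto simp: C_def T'_def)
  have \<phi>T': "\<phi> i = i" if "i \<in> T'" for i
    using that CV T'T V_subset disjoint by (auto simp: \<phi>_def)
  have bij: "bij_betw \<phi> (C \<union> T') T"
  proof (intro bij_betw_imageI)
    have "\<phi> i \<noteq> j" if "i \<in> C" "j \<in> T'" for i j
      using \<phi>C[OF that(1)] that CV by (auto simp: T'_def)
    moreover have "i = j" if "i \<in> C" "j \<in> C" "\<phi> i = \<phi> j" for i j
      using F_col[of "\<phi> i" i j] \<phi>C that CV by force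
    ultimately show "inj_on \<phi> (C \<union> T')"
      using \<phi>T' by (intro inj_onI) (metis Un_iff)
    have "t \<in> \<phi> ` (C \<union> T')" if t: "t \<in> T" for t
    proof (cases "t \<in> T'")
      case True then show ?thesis using \<phi>T' by force
    next
      case False
      then obtain i where i: "i \<in> V" "F t i \<noteq> 0" using t by (auto simp: T'_def)
      then have "i \<in> C" using t by (auto simp: C_def)
      then have "\<phi> i = t" using F_row[OF _ t i(1) _ i(2)] \<phi>C by simp
      then show ?thesis using \<open>i \<in> C\<close> by force
    qed
    then show "\<phi> ` (C \<union> T') = T" using \<phi>C \<phi>T' T'T by auto
  qed
  have unm: "\<exists>i\<in>V. F t i \<noteq> 0 \<and> R i v" if "v \<in> V - C" "t \<in> T" for v t
    using unmatched_column[OF F, of v t] that by (auto simp: C_def)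
  interpret matched_extension T J V R C T' \<phi>
  proof
    show "V = C \<or> T' = {}"
      using unm CV by (fastforce simp: T'_def)
    fix i j assume ij: "i \<in> C" "j \<in> V - C"
    then obtain k where "k \<in> V" "F (\<phi> i) k \<noteq> 0" "R k j" using unm \<phi>C by blast
    then show "R i j" using F_col[of "\<phi> i" i k] \<phi>C[OF ij(1)] ij CV by auto
  qed (use CV T'T bij \<phi>T' in auto)
  have "matched_form F"
    unfolding matched_form_def
  proof (intro ballI)
    fix t i assume ti: "t \<in> T" "i \<in> V"
    show "F t i = (if i \<in> C \<and> \<phi> i = t then 1 else 0)"
    proof (cases "F t i = 0")
      case True then show ?thesis using \<phi>C by auto
    next
      case False
      then have "i \<in> C" using ti by (auto simp: C_def)
      then have "\<phi> i = t" using F_row[OF _ ti(1,2) _ False] \<phi>C by simp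
      then show ?thesis using F1 ti False \<open>i \<in> C\<close> by simp
    qed
  qed
  then have "frobenius_pattern TYPE('k) I' R'"
    using frobenius_form_iff_reduced F by (auto simp: frobenius_pattern_def)
  then show ?thesis using that matched_extension_axioms by blast
qed

section \<open>Reduction of seaweed patterns\<close>

text \<open>The positions at which matrices of the seaweed with diagonal block sizes \<open>p\<close> and \<open>q\<close> may be
  nonzero.\<close>

definition seaweed_rel :: "nat list \<Rightarrow> nat list \<Rightarrow> nat \<Rightarrow> nat \<Rightarrow> bool" where
  "seaweed_rel p q i j \<longleftrightarrow> block_index p i \<le> block_index p j \<and> block_index q j \<le> block_index q i"

definition frobenius_seaweed :: "'k::field itself \<Rightarrow> nat list \<Rightarrow> nat list \<Rightarrow> bool" where
  "frobenius_seaweed K p q \<longleftrightarrow> frobenius_pattern K {..<sum_list p} (seaweed_rel p q)"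

lemma block_index_Cons:
  assumes "i < a + sum_list c"
  shows "block_index (a # c) i = (if i < a then 0 else Suc (block_index c (i - a)))"
proof (cases "i < a")
  case True
  then show ?thesis unfolding block_index_def by (auto intro: Least_equality)
next
  case False
  have "i < sum_list (take (Suc (length c)) (a # c))" using assms by simp
  then have "block_index (a # c) i = Suc (LEAST r. i < sum_list (take (Suc (Suc r)) (a # c)))"
    unfolding block_index_def using False by (intro Least_Suc[of _ "length c"]) auto
  also have "(LEAST r. i < sum_list (take (Suc (Suc r)) (a # c))) = block_index c (i - a)"
    unfolding block_index_def using False
    by (intro arg_cong[where f = Least] ext) (auto simp: less_diff_conv2)
  finally show ?thesis using False by simp
qed

lemma block_index_mono:
  assumes "i \<le> j" "j < sum_list c"
  shows "block_index c i \<le> block_index c j"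
  unfolding block_index_def
proof (rule Least_le)
  have "j < sum_list (take (Suc (length c)) c)" using assms by simp
  then have "j < sum_list (take (Suc (LEAST r. j < sum_list (take (Suc r) c))) c)" by (rule LeastI)
  then show "i < sum_list (take (Suc (LEAST r. j < sum_list (take (Suc r) c))) c)" using assms by simp
qed

lemma frobenius_seaweed_swap:
  assumes "sum_list p = sum_list q" "frobenius_seaweed TYPE('k::field) p q"
  shows "frobenius_seaweed TYPE('k) q p"
proof -
  have "seaweed_rel q p = (\<lambda>i j. seaweed_rel p q j i)" by (auto simp: seaweed_rel_def fun_eq_iff)
  then show ?thesis
    using frobenius_pattern_transpose assms by (metis frobenius_seaweed_def)
qed

text \<open>Allowing a part zero unifies the step for \<open>v < t\<close> with the one for \<open>v = t\<close>.\<close>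

lemma frobenius_seaweed_zero_part:
  assumes "sum_list p = sum_list q"
  shows "frobenius_seaweed TYPE('k::field) p (0 # q) \<longleftrightarrow> frobenius_seaweed TYPE('k) p q"
  unfolding frobenius_seaweed_def
  using assms by (intro frobenius_pattern_cong) (auto simp: seaweed_rel_def block_index_Cons)

text \<open>Two sets of the same size that are both upper sets for the weak order given by \<open>g\<close> differ only inside
  one level of \<open>g\<close>, so the difference can be interchanged by a level preserving permutation.\<close>

lemma swap_final_segments:
  fixes g :: "'a \<Rightarrow> nat"
  assumes "finite V" and C: "C \<subseteq> V" and D: "D \<subseteq> V" and card: "card C = card D"
    and gC: "\<And>i j. i \<in> C \<Longrightarrow> j \<in> V - C \<Longrightarrow> g j \<le> g i"
    and gD: "\<And>i j. i \<in> D \<Longrightarrow> j \<in> V - D \<Longrightarrow> g j \<le> g i"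
  shows "\<exists>s. bij_betw s V V \<and> (\<forall>i\<in>V. (s i \<in> C \<longleftrightarrow> i \<in> D) \<and> g (s i) = g i)"
proof -
  have fin: "finite C" "finite D" using assms finite_subset by auto
  have "card (D - C) + card (D \<inter> C) = card (C - D) + card (D \<inter> C)"
    using card_Diff_subset_Int[of D C] card_Diff_subset_Int[of C D] fin card
      card_mono[of D "D \<inter> C"] card_mono[of C "D \<inter> C"] by (simp add: Int_commute)
  then obtain b where b: "bij_betw b (D - C) (C - D)"
    using finite_same_card_bij[of "D - C" "C - D"] fin by auto
  define b' where "b' = inv_into (D - C) b"
  have b1: "b i \<in> C - D" "b' (b i) = i" if "i \<in> D - C" for i
    using that b by (auto simp: b'_def bij_betw_def)
  have b2: "b' i \<in> D - C" "b (b' i) = i" if "i \<in> C - D" for i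
    using that b f_inv_into_f[of i b "D - C"] inv_into_into[of i b "D - C"]
    by (simp_all add: b'_def bij_betw_def)
  have geq: "g i = g j" if "i \<in> D - C" "j \<in> C - D" for i j
    using gC[of j i] gD[of i j] that C D by (intro antisym) auto
  define s where "s = (\<lambda>i. if i \<in> D - C then b i else if i \<in> C - D then b' i else i)"
  \<comment> \<open>The map \<open>s\<close> is the involution that exchanges \<open>D - C\<close> with \<open>C - D\<close>.\<close>
  have inv: "s (s i) = i" for i
    using b1[of i] b2[of i] by (auto simp: s_def)
  have sV: "s i \<in> V" if "i \<in> V" for i
    using that b1[of i] b2[of i] C D by (auto simp: s_def)
  have "bij_betw s V V"
    using inv sV by (intro bij_betw_byWitness[of _ s]) auto
  moreover have "(s i \<in> C \<longleftrightarrow> i \<in> D) \<and> g (s i) = g i" if "i \<in> V" for i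
    using b1[of i] b2[of i] geq[of i "b i"] geq[of "b' i" i] by (auto simp: s_def)
  ultimately show ?thesis by blast
qed

text \<open>The pair with lists \<open>(t + v) # p\<close> and \<open>t # q\<close>, whose first positions \<open>T = {..<t}\<close> are to be peeled
  off; \<open>V = {t..<t + v}\<close> is the rest of the first upper block.\<close>

locale seaweed_step =
  fixes t v :: nat and p q :: "nat list"
  assumes t_pos: "0 < t" and sums: "v + sum_list p = sum_list q"
begin

definition R where "R = seaweed_rel ((t + v) # p) (t # q)"

lemma R_iff:
  assumes "i < t + sum_list q" "j < t + sum_list q"
  shows "R i j \<longleftrightarrow>
    (i < t + v \<or> t + v \<le> j \<and> block_index p (i - (t + v)) \<le> block_index p (j - (t + v))) \<and>
    (j < t \<or> t \<le> i \<and> block_index q (j - t) \<le> block_index q (i - t))"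
  using assms sums by (auto simp: R_def seaweed_rel_def block_index_Cons)

lemma pattern: "frobenius_seaweed TYPE('k::field) ((t + v) # p) (t # q) \<longleftrightarrow>
    frobenius_pattern TYPE('k) ({..<t} \<union> {t..<t + sum_list q}) R"
proof -
  have "{..<t} \<union> {t..<t + sum_list q} = {..<t + sum_list q}" by auto
  then show ?thesis by (simp add: frobenius_seaweed_def R_def sums add.assoc)
qed

sublocale block_extension "{..<t}" "{t..<t + sum_list q}" "{t..<t + v}" R
proof
  fix i j k assume "i \<in> {..<t} \<union> {t..<t + sum_list q}" "j \<in> {..<t} \<union> {t..<t + sum_list q}"
    "k \<in> {..<t} \<union> {t..<t + sum_list q}" "R i j" "R j k"
  then show "R i k" by (auto simp: R_def seaweed_rel_def)
next
  fix i j assume "i \<in> {t..<t + v}" "j \<in> {t..<t + v}" "j \<le> i"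
  then show "R i j"
    using R_iff[of i j] sums block_index_mono[of "j - t" "i - t" q] by auto
qed (use t_pos sums R_iff in \<open>auto simp: R_def seaweed_rel_def\<close>)

text \<open>As \<open>T\<close> is a full block, any \<open>t - v\<close> of its positions carry the same pattern, so the unmatched ones may
  be numbered consecutively.\<close>

lemma reduced_pattern_iso_le:
  assumes "matched_extension {..<t} {t..<t + sum_list q} {t..<t + v} R {t..<t + v} T' \<phi>"
    and "v \<le> t" "card T' = t - v"
  shows "\<exists>\<pi>. bij_betw \<pi> {..<sum_list (t # p)} (T' \<union> {t..<t + sum_list q}) \<and>
    (\<forall>i\<in>{..<sum_list (t # p)}. \<forall>j\<in>{..<sum_list (t # p)}.
       seaweed_rel (t # p) ((t - v) # q) i j \<longleftrightarrow>
       matched_extension.R' {t..<t + v} R {t..<t + v} (\<pi> i) (\<pi> j))"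
proof -
  interpret m: matched_extension "{..<t}" "{t..<t + sum_list q}" "{t..<t + v}" R "{t..<t + v}" T' \<phi>
    by fact
  have "finite T'" using m.T'_subset finite_subset by blast
  then obtain e where e: "bij_betw e {..<t - v} T'"
    using finite_same_card_bij[of "{..<t - v}" T'] assms by auto
  define \<pi> where "\<pi> k = (if k < t - v then e k else k + v)" for k
  have et: "e k < t" if "k < t - v" for k
    using that e m.T'_subset by (auto simp: bij_betw_def)
  have n: "sum_list (t # p) = t - v + sum_list q" using sums assms by simp
  have "bij_betw \<pi> ({..<t - v} \<union> {t - v..<t - v + sum_list q}) (T' \<union> {t..<t + sum_list q})"
  proof (rule bij_betw_combine)
    show "bij_betw \<pi> {..<t - v} T'"
      using e by (rule iffD1[OF bij_betw_cong, rotated]) (auto simp: \<pi>_def)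
    show "bij_betw \<pi> {t - v..<t - v + sum_list q} {t..<t + sum_list q}"
      using assms(2) by (intro bij_betw_byWitness[of _ "\<lambda>k. k - v"]) (auto simp: \<pi>_def)
  qed (use m.T'_subset in auto)
  moreover have "{..<t - v} \<union> {t - v..<t - v + sum_list q} = {..<sum_list (t # p)}"
    using n by auto
  moreover have "seaweed_rel (t # p) ((t - v) # q) i j \<longleftrightarrow> m.R' (\<pi> i) (\<pi> j)"
    if ij: "i < sum_list (t # p)" "j < sum_list (t # p)" for i j
  proof -
    have lt: "\<pi> i < t + sum_list q" "\<pi> j < t + sum_list q"
      using ij n et assms(2) by (auto simp: \<pi>_def dest!: et)
    have s: "i - (t - v) = \<pi> i - t" if "\<not> i < t - v" for i using that assms(2) by (simp add: \<pi>_def)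
    have s': "i - t = \<pi> i - (t + v)" if "\<not> i < t - v" for i using that assms(2) by (simp add: \<pi>_def)
    have l: "\<pi> i < t \<longleftrightarrow> i < t - v" "\<pi> i < t + v \<longleftrightarrow> i < t" for i
      using et[of i] assms(2) by (auto simp: \<pi>_def)
    show ?thesis
      using ij n R_iff[OF lt] l[of i] l[of j] s[of i] s[of j] s'[of i] s'[of j]
      by (auto simp: m.R'_def seaweed_rel_def block_index_Cons not_less)
  qed
  ultimately show ?thesis by (intro exI[of _ \<pi>]) auto
qed

text \<open>The matched columns may be any upper set of \<open>V\<close> of size \<open>t\<close>. Up to a permutation within the lower
  blocks they are the last \<open>t\<close> positions of \<open>V\<close>, and removing the entries from the first \<open>v - t\<close>
  columns to these rows splits the first upper block into parts \<open>v - t\<close> and \<open>t\<close>.\<close>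

lemma reduced_pattern_iso_less:
  assumes "matched_extension {..<t} {t..<t + sum_list q} {t..<t + v} R C {} \<phi>"
    and tv: "t < v"
  shows "\<exists>\<pi>. bij_betw \<pi> {..<sum_list q} {t..<t + sum_list q} \<and>
    (\<forall>i\<in>{..<sum_list q}. \<forall>j\<in>{..<sum_list q}.
       seaweed_rel ((v - t) # t # p) q i j \<longleftrightarrow>
       matched_extension.R' {t..<t + v} R C (\<pi> i) (\<pi> j))"
proof -
  interpret m: matched_extension "{..<t}" "{t..<t + sum_list q}" "{t..<t + v}" R C "{}" \<phi>
    by fact
  define g where "g i = block_index q (i - t)" for i
  have card: "card C = card {v..<t + v}"
    using bij_betw_same_card[OF m.\<phi>_bij] by simp
  have "g j \<le> g i" if "i \<in> C" "j \<in> {t..<t + v} - C" for i j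
    using m.C_above[OF that] that m.C_subset sums R_iff[of i j] by (auto simp: g_def)
  moreover have "g j \<le> g i" if "i \<in> {v..<t + v}" "j \<in> {t..<t + v} - {v..<t + v}" for i j
    using that sums by (auto simp: g_def intro!: block_index_mono)
  ultimately obtain s where s: "bij_betw s {t..<t + v} {t..<t + v}"
    and sC: "\<And>i. i \<in> {t..<t + v} \<Longrightarrow> s i \<in> C \<longleftrightarrow> i \<in> {v..<t + v}"
    and sg: "\<And>i. i \<in> {t..<t + v} \<Longrightarrow> g (s i) = g i"
    using swap_final_segments[of "{t..<t + v}" C "{v..<t + v}" g] m.C_subset card tv by force
  define \<pi> where "\<pi> k = (if k < v then s (k + t) else k + t)" for k
  have sV: "t \<le> s (k + t)" "s (k + t) < t + v" if "k < v" for k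
    using that bij_betwE[OF s] by auto
  have "bij_betw \<pi> ({..<v} \<union> {v..<sum_list q}) ({t..<t + v} \<union> {t + v..<t + sum_list q})"
  proof (rule bij_betw_combine)
    have "bij_betw (\<lambda>k. k + t) {..<v} {t..<t + v}"
      by (intro bij_betw_byWitness[of _ "\<lambda>k. k - t"]) auto
    then have "bij_betw (s \<circ> (\<lambda>k. k + t)) {..<v} {t..<t + v}"
      using s by (rule bij_betw_trans)
    then show "bij_betw \<pi> {..<v} {t..<t + v}"
      by (rule iffD1[OF bij_betw_cong, rotated]) (auto simp: \<pi>_def)
    show "bij_betw \<pi> {v..<sum_list q} {t + v..<t + sum_list q}"
      by (intro bij_betw_byWitness[of _ "\<lambda>k. k - t"]) (auto simp: \<pi>_def)
  qed auto
  moreover have "{..<v} \<union> {v..<sum_list q} = {..<sum_list q}"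
    "{t..<t + v} \<union> {t + v..<t + sum_list q} = {t..<t + sum_list q}"
    using sums by auto
  moreover have "seaweed_rel ((v - t) # t # p) q i j \<longleftrightarrow> m.R' (\<pi> i) (\<pi> j)"
    if ij: "i < sum_list q" "j < sum_list q" for i j
  proof -
    have lt: "\<pi> i < t + sum_list q" "\<pi> j < t + sum_list q"
      using ij sV[of i] sV[of j] sums by (auto simp: \<pi>_def)
    have ge: "\<not> \<pi> i < t" for i using sV[of i] by (auto simp: \<pi>_def)
    have l: "\<pi> i < t + v \<longleftrightarrow> i < v" for i
      using sV[of i] by (auto simp: \<pi>_def)
    have s': "\<pi> i - (t + v) = i - v" if "\<not> i < v" for i using that by (simp add: \<pi>_def)
    have gq: "block_index q (\<pi> i - t) = block_index q i" for i
      using sg[of "i + t"] by (auto simp: \<pi>_def g_def)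
    have cC: "\<pi> i \<in> C \<longleftrightarrow> v - t \<le> i \<and> i < v" for i
      using sC[of "i + t"] m.C_subset tv by (auto simp: \<pi>_def)
    have bp: "block_index ((v - t) # t # p) k =
        (if k < v - t then 0 else if k < v then 1 else Suc (Suc (block_index p (k - v))))"
      if "k < sum_list q" for k
      using that sums tv by (simp add: block_index_Cons) arith
    show ?thesis
      unfolding seaweed_rel_def bp[OF ij(1)] bp[OF ij(2)] m.R'_def R_iff[OF lt]
      using l[of i] l[of j] s'[of i] s'[of j] gq[of i] gq[of j] cC[of i] cC[of j] ge[of i] ge[of j] tv
      by auto
  qed
  ultimately show ?thesis by (intro exI[of _ \<pi>]) auto
qed

lemma matched_extension_le:
  assumes "v \<le> t"
  shows "matched_extension {..<t} {t..<t + sum_list q} {t..<t + v} R {t..<t + v} {..<t - v}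
    (\<lambda>i. if i < t then i else i - v)"
proof
  show "bij_betw (\<lambda>i. if i < t then i else i - v) ({t..<t + v} \<union> {..<t - v}) {..<t}"
    using assms by (intro bij_betw_byWitness[of _ "\<lambda>i. if i < t - v then i else i + v"]) auto
qed (use assms in auto)

lemma matched_extension_less:
  assumes "t < v"
  shows "matched_extension {..<t} {t..<t + sum_list q} {t..<t + v} R {v..<t + v} {} (\<lambda>i. i - v)"
proof
  show "bij_betw (\<lambda>i. i - v) ({v..<t + v} \<union> {}) {..<t}"
    by (intro bij_betw_byWitness[of _ "\<lambda>i. i + v"]) auto
  fix i j assume "i \<in> {v..<t + v}" "j \<in> {t..<t + v} - {v..<t + v}"
  then show "R i j" using V_lower[of i j] assms by auto
qed (use assms in auto)

text \<open>The numbers of unmatched rows and of unmatched columns differ by \<open>t - v\<close>, and one of them is zero; so for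
  \<open>v \<le> t\<close> every column is matched.\<close>

lemma frobenius_step_le:
  assumes v: "v \<le> t"
  shows "frobenius_seaweed TYPE('k::field) ((t + v) # p) (t # q) \<longleftrightarrow>
    frobenius_seaweed TYPE('k) (t # p) ((t - v) # q)"
proof
  assume "frobenius_seaweed TYPE('k) ((t + v) # p) (t # q)"
  then obtain C T' \<phi> where m: "matched_extension {..<t} {t..<t + sum_list q} {t..<t + v} R C T' \<phi>"
    and fr: "frobenius_pattern TYPE('k) (T' \<union> {t..<t + sum_list q}) (matched_extension.R' {t..<t + v} R C)"
    using frobenius_pattern_reduce unfolding pattern by blast
  interpret m: matched_extension "{..<t}" "{t..<t + sum_list q}" "{t..<t + v}" R C T' \<phi> by (rule m)
  have fC: "finite C" "finite T'" using m.C_subset m.T'_subset finite_subset by blast+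
  have "C \<inter> T' = {}" using m.T'_T(4) by blast
  then have "card C + card T' = t"
    using bij_betw_same_card[OF m.\<phi>_bij] card_Un_disjoint[OF fC] by simp
  moreover have C: "C = {t..<t + v}"
    using m.saturated calculation v m.C_subset card_seteq[of "{t..<t + v}" C] by auto
  ultimately have "card T' = t - v" by simp
  then obtain \<pi> where bij: "bij_betw \<pi> {..<sum_list (t # p)} (T' \<union> {t..<t + sum_list q})"
    and rel: "\<forall>i\<in>{..<sum_list (t # p)}. \<forall>j\<in>{..<sum_list (t # p)}.
       seaweed_rel (t # p) ((t - v) # q) i j \<longleftrightarrow> m.R' (\<pi> i) (\<pi> j)"
    using reduced_pattern_iso_le[OF m[unfolded C] v] unfolding C by blast
  show "frobenius_seaweed TYPE('k) (t # p) ((t - v) # q)"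
    unfolding frobenius_seaweed_def
    by (rule frobenius_pattern_iso[OF bij _ fr]) (use rel in blast)
next
  interpret m: matched_extension "{..<t}" "{t..<t + sum_list q}" "{t..<t + v}" R "{t..<t + v}" "{..<t - v}"
    "\<lambda>i. if i < t then i else i - v"
    by (rule matched_extension_le[OF v])
  assume fr: "frobenius_seaweed TYPE('k) (t # p) ((t - v) # q)"
  obtain \<pi> where bij: "bij_betw \<pi> {..<sum_list (t # p)} ({..<t - v} \<union> {t..<t + sum_list q})"
    and rel: "\<forall>i\<in>{..<sum_list (t # p)}. \<forall>j\<in>{..<sum_list (t # p)}.
       seaweed_rel (t # p) ((t - v) # q) i j \<longleftrightarrow> m.R' (\<pi> i) (\<pi> j)"
    using reduced_pattern_iso_le[OF m.matched_extension_axioms v] by auto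
  have "frobenius_pattern TYPE('k) ({..<t - v} \<union> {t..<t + sum_list q}) m.R'"
    by (rule frobenius_pattern_iso_inv[OF bij _ fr[unfolded frobenius_seaweed_def]]) (use rel in blast)
  then show "frobenius_seaweed TYPE('k) ((t + v) # p) (t # q)"
    unfolding pattern by (rule m.frobenius_pattern_extend)
qed

text \<open>For \<open>t < v\<close> the same count shows that every row is matched.\<close>

lemma frobenius_step_less:
  assumes v: "t < v"
  shows "frobenius_seaweed TYPE('k::field) ((t + v) # p) (t # q) \<longleftrightarrow>
    frobenius_seaweed TYPE('k) ((v - t) # t # p) q"
proof
  have n: "sum_list ((v - t) # t # p) = sum_list q" using sums v by simp
  assume "frobenius_seaweed TYPE('k) ((t + v) # p) (t # q)"
  then obtain C T' \<phi> where m: "matched_extension {..<t} {t..<t + sum_list q} {t..<t + v} R C T' \<phi>"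
    and fr: "frobenius_pattern TYPE('k) (T' \<union> {t..<t + sum_list q}) (matched_extension.R' {t..<t + v} R C)"
    using frobenius_pattern_reduce unfolding pattern by blast
  interpret m: matched_extension "{..<t}" "{t..<t + sum_list q}" "{t..<t + v}" R C T' \<phi> by (rule m)
  have fC: "finite C" "finite T'" using m.C_subset m.T'_subset finite_subset by blast+
  have "C \<inter> T' = {}" using m.T'_T(4) by blast
  then have "card C + card T' = t"
    using bij_betw_same_card[OF m.\<phi>_bij] card_Un_disjoint[OF fC] by simp
  then have "C \<noteq> {t..<t + v}" using v by (metis card_atLeastLessThan add_diff_cancel_left' le_add1 not_less)
  then have T': "T' = {}" using m.saturated by auto
  obtain \<pi> where bij: "bij_betw \<pi> {..<sum_list q} {t..<t + sum_list q}"
    and rel: "\<forall>i\<in>{..<sum_list q}. \<forall>j\<in>{..<sum_list q}.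
       seaweed_rel ((v - t) # t # p) q i j \<longleftrightarrow> m.R' (\<pi> i) (\<pi> j)"
    using reduced_pattern_iso_less[OF m[unfolded T'] v] by blast
  show "frobenius_seaweed TYPE('k) ((v - t) # t # p) q"
    unfolding frobenius_seaweed_def n
    by (rule frobenius_pattern_iso[OF bij _ fr[unfolded T' Un_empty_left]]) (use rel in blast)
next
  have n: "sum_list ((v - t) # t # p) = sum_list q" using sums v by simp
  interpret m: matched_extension "{..<t}" "{t..<t + sum_list q}" "{t..<t + v}" R "{v..<t + v}" "{}"
    "\<lambda>i. i - v"
    by (rule matched_extension_less[OF v])
  assume fr: "frobenius_seaweed TYPE('k) ((v - t) # t # p) q"
  obtain \<pi> where bij: "bij_betw \<pi> {..<sum_list q} ({} \<union> {t..<t + sum_list q})"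
    and rel: "\<forall>i\<in>{..<sum_list q}. \<forall>j\<in>{..<sum_list q}.
       seaweed_rel ((v - t) # t # p) q i j \<longleftrightarrow> m.R' (\<pi> i) (\<pi> j)"
    using reduced_pattern_iso_less[OF m.matched_extension_axioms v] by auto
  have "frobenius_pattern TYPE('k) ({} \<union> {t..<t + sum_list q}) m.R'"
    by (rule frobenius_pattern_iso_inv[OF bij _ fr[unfolded frobenius_seaweed_def n]]) (use rel in blast)
  then show "frobenius_seaweed TYPE('k) ((t + v) # p) (t # q)"
    unfolding pattern by (rule m.frobenius_pattern_extend)
qed

end

text \<open>The step with \<open>t = (m + 2) * x\<close> and \<open>v = x\<close> lowers \<open>m\<close> by one, and for \<open>m = 0\<close> the step with
  \<open>t = v = x\<close> ends the process.\<close>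

lemma frobenius_seaweed_sigma:
  assumes "0 < x" "x + sum_list p = sum_list q"
  shows "frobenius_seaweed TYPE('k::field) (((m + 2) * x) # p) (((m + 1) * x) # q) \<longleftrightarrow>
    frobenius_seaweed TYPE('k) (x # p) q"
proof (induction m)
  case 0
  interpret seaweed_step x x p q by unfold_locales (use assms in auto)
  have "frobenius_seaweed TYPE('k) ((x + x) # p) (x # q) \<longleftrightarrow>
     frobenius_seaweed TYPE('k) (x # p) ((x - x) # q)"
    by (rule frobenius_step_le) simp
  then show ?case using assms by (simp add: mult_2 frobenius_seaweed_zero_part)
next
  case (Suc m)
  interpret seaweed_step "(m + 2) * x" x p q by unfold_locales (use assms in auto)
  have "frobenius_seaweed TYPE('k) (((m + 2) * x + x) # p) (((m + 2) * x) # q) \<longleftrightarrow>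
     frobenius_seaweed TYPE('k) (((m + 2) * x) # p) (((m + 2) * x - x) # q)"
    by (rule frobenius_step_le) simp
  moreover have "(m + 2) * x - x = (m + 1) * x" "(m + 2) * x + x = (Suc m + 2) * x"
    "(m + 2) * x = (Suc m + 1) * x"
    by (simp_all add: algebra_simps)
  ultimately show ?case using Suc by metis
qed

text \<open>Here \<open>v = x + y\<close> throughout. The step lowers \<open>m\<close> by one as long as \<open>v\<close> is at most the first lower
  part, and for \<open>m = 0\<close>, where \<open>t = y < v\<close>, it splits the first upper part.\<close>

lemma frobenius_seaweed_tau:
  assumes "0 < x" "0 < y" "x + y + sum_list p = sum_list q"
  shows "frobenius_seaweed TYPE('k::field) (((m + 1) * x + (m + 2) * y) # p) ((m * x + (m + 1) * y) # q) \<longleftrightarrow>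
    frobenius_seaweed TYPE('k) (x # y # p) q"
proof (induction m)
  case 0
  interpret seaweed_step y "x + y" p q by unfold_locales (use assms in auto)
  have "frobenius_seaweed TYPE('k) ((y + (x + y)) # p) (y # q) \<longleftrightarrow>
     frobenius_seaweed TYPE('k) ((x + y - y) # y # p) q"
    by (rule frobenius_step_less) (use assms in simp)
  then show ?case by (simp add: mult_2 ac_simps)
next
  case (Suc m)
  let ?t = "(m + 1) * x + (m + 2) * y"
  interpret seaweed_step ?t "x + y" p q by unfold_locales (use assms in auto)
  have "frobenius_seaweed TYPE('k) ((?t + (x + y)) # p) (?t # q) \<longleftrightarrow>
     frobenius_seaweed TYPE('k) (?t # p) ((?t - (x + y)) # q)"
    by (rule frobenius_step_le) simp
  moreover have "?t - (x + y) = m * x + (m + 1) * y" "?t + (x + y) = (Suc m + 1) * x + (Suc m + 2) * y"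
    "?t = Suc m * x + (Suc m + 1) * y"
    by (simp_all add: algebra_simps)
  ultimately show ?case using Suc by metis
qed

text \<open>If further positions exist, the identity of the first block is central and not scalar. If there
  are none, the algebra is a full matrix algebra and \<open>F\<close> commutes with itself; then \<open>F\<close> is scalar, and
  everything commutes with it.\<close>

lemma frobenius_seaweed_equal_first_parts:
  assumes fr: "frobenius_seaweed TYPE('k::field) (s # p) (s # q)"
    and s: "0 < s" and sums: "sum_list p = sum_list q"
    and pos: "\<forall>x\<in>set p. 0 < x" "\<forall>x\<in>set q. 0 < x"
  shows "s = 1 \<and> p = [] \<and> q = []"
proof -
  let ?n = "s + sum_list p" and ?R = "seaweed_rel (s # p) (s # q)"
  obtain F :: "nat \<Rightarrow> nat \<Rightarrow> 'k" where F: "frobenius_form {..<?n} ?R F"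
    using fr by (auto simp: frobenius_seaweed_def frobenius_pattern_def)
  have block: "i < s \<longleftrightarrow> j < s" if "i < ?n" "j < ?n" "?R i j" for i j
    using that sums by (auto simp: seaweed_rel_def block_index_Cons split: if_splits)
  have "sum_list p = 0"
  proof (rule ccontr)
    assume 0: "sum_list p \<noteq> 0"
    define x :: "nat \<Rightarrow> nat \<Rightarrow> 'k" where "x i j = (if i = j \<and> i < s then 1 else 0)" for i j
    have "mprod {..<?n} F x j i = (\<Sum>k<?n. if k = i then (if i < s then F j i else 0) else 0)" for i j
      unfolding mprod_def by (intro sum.cong) (auto simp: x_def)
    moreover have "mprod {..<?n} x F j i = (\<Sum>k<?n. if k = j then (if j < s then F j i else 0) else 0)" for i j
      unfolding mprod_def by (intro sum.cong) (auto simp: x_def)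
    moreover have "x \<in> pattern_algebra {..<?n} ?R"
      by (auto simp: pattern_algebra_def x_def seaweed_rel_def)
    ultimately have "x \<in> stabilizer {..<?n} ?R F"
      using block by (auto simp: stabilizer_def)
    then obtain c where "\<And>i j. i < ?n \<Longrightarrow> j < ?n \<Longrightarrow> x i j = (if i = j then c else 0)"
      using F by (fastforce simp: frobenius_form_def scalar_on_def)
    moreover have "0 < ?n" "s < ?n" using s 0 by linarith+
    ultimately have "x 0 0 = c" "x s s = c" by simp_all
    then show False using s by (simp add: x_def)
  qed
  then have pq: "p = []" "q = []" using pos sums by (cases p; cases q; auto)+
  have R: "?R i j" if "i < s" "j < s" for i j
    using that pq by (simp add: seaweed_rel_def block_index_Cons)
  have n: "?n = s" using pq by simp
  define G where "G i j = (if i < s \<and> j < s then F i j else 0)" for i j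
  have "G \<in> stabilizer {..<s} ?R F"
    using R by (auto simp: stabilizer_def pattern_algebra_def mprod_def G_def intro!: sum.cong)
  then obtain c where c: "\<And>i j. i < s \<Longrightarrow> j < s \<Longrightarrow> F i j = (if i = j then c else 0)"
    using F n by (fastforce simp: frobenius_form_def scalar_on_def G_def)
  have "s = 1"
  proof (rule ccontr)
    assume "s \<noteq> 1"
    then have s2: "1 < s" using s by simp
    define x :: "nat \<Rightarrow> nat \<Rightarrow> 'k" where "x i j = (if i = 0 \<and> j = 1 then 1 else 0)" for i j
    have "mprod {..<s} F x j i = (\<Sum>k<s. if k = j then c * x j i else 0)" if "j < s" for i j
      unfolding mprod_def using c that by (intro sum.cong) auto
    moreover have "mprod {..<s} x F j i = (\<Sum>k<s. if k = i then c * x j i else 0)" if "i < s" for i j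
      unfolding mprod_def using c that by (intro sum.cong) auto
    moreover have "x \<in> pattern_algebra {..<s} ?R"
      using R s2 by (auto simp: pattern_algebra_def x_def split: if_splits)
    ultimately have "x \<in> stabilizer {..<s} ?R F" by (auto simp: stabilizer_def)
    then obtain d where "\<And>i j. i < s \<Longrightarrow> j < s \<Longrightarrow> x i j = (if i = j then d else 0)"
      using F n by (fastforce simp: frobenius_form_def scalar_on_def)
    from this[of 0 1] show False using s2 by (simp add: x_def)
  qed
  then show ?thesis using pq by simp
qed

lemma frobenius_seaweed_unit: "frobenius_seaweed TYPE('k::field) [1] [1]"
  by (auto simp: frobenius_seaweed_def frobenius_pattern_def frobenius_form_def scalar_on_def)

section \<open>Dimension zero for spaces of matrices\<close>

text \<open>Linearly independent subsets of the subspace are bounded in size by the dimension of the whole space,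
  and a maximal one spans the subspace.\<close>

lemma (in vectorspace) subspace_fin_dim:
  assumes "fin_dim" and W: "subspace K W V"
  shows "vectorspace.fin_dim K (vs W)"
proof -
  interpret W: vectorspace K "vs W" using W by (rule subspace_is_vs)
  have sub: "submodule K W V" using W by (simp add: subspace_def)
  then have WV: "W \<subseteq> carrier V" by (simp add: submodule_def)
  have "finite A \<and> card A \<le> dim" if A: "A \<subseteq> carrier (vs W) \<and> W.lin_indpt A" for A
  proof -
    have "lin_indpt A" using A span_li_not_depend(2)[OF _ sub, of A] by simp
    then show ?thesis using li_le_dim[OF assms(1), of A] A WV by auto
  qed
  moreover have "{} \<subseteq> carrier (vs W) \<and> W.lin_indpt {}" by (simp add: W.lin_dep_def)
  ultimately have "\<exists>A. finite A \<and> maximal A (\<lambda>S. S \<subseteq> carrier (vs W) \<and> W.lin_indpt S)"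
    by (rule maximal_exists)
  then obtain A where A: "finite A" "maximal A (\<lambda>S. S \<subseteq> carrier (vs W) \<and> W.lin_indpt S)" by blast
  then show ?thesis
    using W.max_li_is_gen[OF A(2)] unfolding W.fin_dim_def maximal_def by blast
qed

lemma (in vectorspace) dim_eq_0_iff:
  assumes "fin_dim"
  shows "dim = 0 \<longleftrightarrow> carrier V = {\<zero>\<^bsub>V\<^esub>}"
proof
  assume 0: "dim = 0"
  have "\<exists>n A. finite A \<and> card A = n \<and> A \<subseteq> carrier V \<and> gen_set A"
    using assms by (auto simp: fin_dim_def)
  then have "\<exists>A. finite A \<and> card A = dim \<and> A \<subseteq> carrier V \<and> gen_set A"
    unfolding dim_def by (rule LeastI_ex)
  then have "gen_set {}" using 0 by auto
  then show "carrier V = {\<zero>\<^bsub>V\<^esub>}" by (simp add: span_empty)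
next
  assume "carrier V = {\<zero>\<^bsub>V\<^esub>}"
  then have "gen_set {}" by (simp add: span_empty)
  then show "dim = 0" unfolding dim_def by (intro Least_eq_0 exI[of _ "{}"]) auto
qed

text \<open>Reshaping vectors of length \<open>n * m\<close> into matrices is a surjective linear map.\<close>

lemma matrix_space_fin_dim:
  "vectorspace.fin_dim class_ring (module_mat TYPE('k::field) n m)"
proof -
  interpret U: vec_space "TYPE('k)" "n * m" .
  define T :: "'k vec \<Rightarrow> 'k mat" where "T v = mat n m (\<lambda>(i, j). v $ (i * m + j))" for v
  have lt: "i * m + j < n * m" if "i < n" "j < m" for i j
  proof -
    have "i * m + j < Suc i * m" using that by simp
    also have "\<dots> \<le> n * m" using that by (intro mult_le_mono1) simp
    finally show ?thesis .
  qed
  have T_add: "T (x + y) = T x + T y" if "x \<in> carrier_vec (n * m)" "y \<in> carrier_vec (n * m)" for x y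
    using that lt by (intro eq_matI) (auto simp: T_def)
  have T_smult: "T (c \<cdot>\<^sub>v x) = c \<cdot>\<^sub>m T x" if "x \<in> carrier_vec (n * m)" for c x
    using that lt by (intro eq_matI) (auto simp: T_def)
  have T_carrier: "T x \<in> carrier_mat n m" for x by (simp add: T_def)
  have "mod_hom class_ring (module_vec TYPE('k) (n * m)) (module_mat TYPE('k) n m) T"
    using vec_vs[where 'a='k] matrix_vs[where 'a='k] T_add T_smult T_carrier
    unfolding mod_hom_def mod_hom_axioms_def LinearCombinations.module_hom_def vectorspace_def
    by (simp add: module_vec_simps module_mat_simps)
  then interpret T: linear_map class_ring "module_vec TYPE('k) (n * m)" "module_mat TYPE('k) n m" T
    by (rule linear_map.intro[OF vec_vs matrix_vs])
  have "T ` carrier_vec (n * m) = carrier_mat n m"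
  proof (intro equalityI subsetI)
    fix A :: "'k mat" assume A: "A \<in> carrier_mat n m"
    have "(i * m + j) div m = i" "(i * m + j) mod m = j" if "j < m" for i j
      using that by simp_all
    then have "A = T (vec (n * m) (\<lambda>k. A $$ (k div m, k mod m)))"
      using A lt by (intro eq_matI) (auto simp: T_def)
    then show "A \<in> T ` carrier_vec (n * m)" using vec_carrier by (rule image_eqI)
  qed (auto simp: T_def)
  then show ?thesis
    using T.surj_fin_dim U.fin_dim by (simp add: module_vec_simps module_mat_simps)
qed

lemma subspace_matrices_dim_eq_0_iff:
  fixes W :: "'k::field mat set"
  assumes "W \<subseteq> carrier_mat n m" "0\<^sub>m n m \<in> W"
    and "\<And>x y. x \<in> W \<Longrightarrow> y \<in> W \<Longrightarrow> x + y \<in> W" "\<And>c x. x \<in> W \<Longrightarrow> c \<cdot>\<^sub>m x \<in> W"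
  shows "vectorspace.dim class_ring ((module_mat TYPE('k) n m)\<lparr>carrier := W\<rparr>) = 0 \<longleftrightarrow> W = {0\<^sub>m n m}"
proof -
  interpret M: vectorspace class_ring "module_mat TYPE('k) n m" by (rule matrix_vs)
  have sub: "subspace class_ring W (module_mat TYPE('k) n m)"
    unfolding subspace_def submodule_def
    using assms matrix_vs M.module_axioms by (auto simp: module_mat_simps)
  interpret W: vectorspace class_ring "M.vs W" using sub by (rule M.subspace_is_vs)
  have "W.fin_dim" by (rule M.subspace_fin_dim[OF matrix_space_fin_dim sub])
  then show ?thesis using W.dim_eq_0_iff by (simp add: module_mat_simps)
qed

section \<open>The index of a seaweed algebra\<close>

definition entries :: "nat \<Rightarrow> 'k::field mat \<Rightarrow> nat \<Rightarrow> nat \<Rightarrow> 'k" where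
  "entries n A i j = (if i < n \<and> j < n then A $$ (i, j) else 0)"

text \<open>The trace of \<open>F A\<close>.\<close>

definition pairing :: "nat \<Rightarrow> (nat \<Rightarrow> nat \<Rightarrow> 'k::field) \<Rightarrow> 'k mat \<Rightarrow> 'k" where
  "pairing n F A = (\<Sum>i<n. \<Sum>j<n. F j i * entries n A i j)"

lemma entries_mult:
  assumes "A \<in> carrier_mat n n" "B \<in> carrier_mat n n" "i < n" "j < n"
  shows "entries n (A * B) i j = mprod {..<n} (entries n A) (entries n B) i j"
  using assms by (simp add: entries_def mprod_def scalar_prod_def atLeast0LessThan)

text \<open>Cyclicity of the trace, with the product resolved into the entries of one factor.\<close>

lemma pairing_mult:
  assumes "A \<in> carrier_mat n n" "B \<in> carrier_mat n n"
  shows "pairing n F (A * B) = (\<Sum>i<n. \<Sum>j<n. mprod {..<n} F (entries n A) j i * entries n B i j)"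
    and "pairing n F (A * B) = (\<Sum>i<n. \<Sum>j<n. mprod {..<n} (entries n B) F j i * entries n A i j)"
proof -
  let ?A = "entries n A" and ?B = "entries n B"
  have e: "pairing n F (A * B) = (\<Sum>i<n. \<Sum>j<n. \<Sum>k<n. F j i * ?A i k * ?B k j)"
    unfolding pairing_def
    by (intro sum.cong HOL.refl) (simp add: entries_mult[OF assms] mprod_def sum_distrib_left mult.assoc)
  also have "\<dots> = (\<Sum>j<n. \<Sum>i<n. \<Sum>k<n. F j i * ?A i k * ?B k j)" by (rule sum.swap)
  also have "\<dots> = (\<Sum>j<n. \<Sum>k<n. \<Sum>i<n. F j i * ?A i k * ?B k j)"
    by (intro sum.cong HOL.refl sum.swap)
  also have "\<dots> = (\<Sum>k<n. \<Sum>j<n. \<Sum>i<n. F j i * ?A i k * ?B k j)" by (rule sum.swap)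
  finally show "pairing n F (A * B) = (\<Sum>i<n. \<Sum>j<n. mprod {..<n} F ?A j i * ?B i j)"
    by (simp add: mprod_def sum_distrib_right)
  have "(\<Sum>i<n. \<Sum>j<n. \<Sum>k<n. F j i * ?A i k * ?B k j) = (\<Sum>i<n. \<Sum>k<n. \<Sum>j<n. F j i * ?A i k * ?B k j)"
    by (intro sum.cong HOL.refl sum.swap)
  then show "pairing n F (A * B) = (\<Sum>i<n. \<Sum>j<n. mprod {..<n} ?B F j i * ?A i j)"
    unfolding e by (simp add: mprod_def sum_distrib_right sum_distrib_left mult_ac)
qed

lemma commutator_carrier:
  assumes "A \<in> carrier_mat n n" "B \<in> carrier_mat n n"
  shows "commutator A B \<in> carrier_mat n n"
  unfolding commutator_def using assms by (meson minus_carrier_mat mult_carrier_mat)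

lemma pairing_commutator_zero:
  assumes "B \<in> carrier_mat n n"
  shows "pairing n F (commutator (0\<^sub>m n n) B) = 0"
proof -
  have "commutator (0\<^sub>m n n) B = 0\<^sub>m n n"
    using assms by (simp add: commutator_def)
  then show ?thesis by (simp add: pairing_def entries_def)
qed

lemma pairing_add:
  assumes "A \<in> carrier_mat n n" "B \<in> carrier_mat n n"
  shows "pairing n F (A + B) = pairing n F A + pairing n F B"
  using assms by (simp add: pairing_def entries_def algebra_simps sum.distrib)

lemma pairing_smult:
  assumes "A \<in> carrier_mat n n"
  shows "pairing n F (c \<cdot>\<^sub>m A) = c * pairing n F A"
  using assms by (simp add: pairing_def entries_def sum_distrib_left mult.left_commute)

lemma sum_unit:
  fixes g :: "nat \<Rightarrow> nat \<Rightarrow> 'k::field"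
  assumes "a < n" "b < n"
  shows "(\<Sum>i<n. \<Sum>j<n. g i j * (if i = a \<and> j = b then 1 else 0)) = g a b"
proof -
  have "(\<Sum>j<n. g i j * (if i = a \<and> j = b then 1 else 0)) = (if i = a then g a b else 0)" for i
  proof -
    have "(\<Sum>j<n. g i j * (if i = a \<and> j = b then 1 else 0)) =
        (\<Sum>j<n. if j = b then (if i = a then g a b else 0) else 0)"
      by (intro sum.cong) auto
    then show ?thesis using assms by simp
  qed
  then show ?thesis using assms by simp
qed

lemma sum_diagonal:
  fixes g :: "nat \<Rightarrow> nat \<Rightarrow> 'k::field"
  shows "(\<Sum>i<n. \<Sum>j<n. g i j * (if i = j then c else 0)) = (\<Sum>i<n. g i i * c)"
proof (intro sum.cong HOL.refl)
  fix i assume "i \<in> {..<n}"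
  moreover have "(\<Sum>j<n. g i j * (if i = j then c else 0)) = (\<Sum>j<n. if j = i then g i i * c else 0)"
    by (intro sum.cong) auto
  ultimately show "(\<Sum>j<n. g i j * (if i = j then c else 0)) = g i i * c" by simp
qed

lemma pairing_commutator:
  assumes A: "A \<in> carrier_mat n n" and B: "B \<in> carrier_mat n n"
  shows "pairing n F (commutator A B) =
    (\<Sum>i<n. \<Sum>j<n. (mprod {..<n} F (entries n A) j i - mprod {..<n} (entries n A) F j i) * entries n B i j)"
proof -
  have "pairing n F (commutator A B) = pairing n F (A * B) - pairing n F (B * A)"
    using A B by (simp add: pairing_def entries_def commutator_def algebra_simps sum_subtractf)
  then show ?thesis
    unfolding pairing_mult(1)[OF A B] pairing_mult(2)[OF B A]
    by (simp add: algebra_simps sum_subtractf)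
qed

text \<open>The Lie algebra of traceless matrices supported on a preorder on \<open>{..<n}\<close>.\<close>

locale traceless_pattern =
  fixes n :: nat and R :: "nat \<Rightarrow> nat \<Rightarrow> bool"
  assumes n_pos: "0 < n"
    and refl: "i < n \<Longrightarrow> R i i"
    and trans: "i < n \<Longrightarrow> j < n \<Longrightarrow> k < n \<Longrightarrow> R i j \<Longrightarrow> R j k \<Longrightarrow> R i k"
begin

definition S :: "'k::field_char_0 mat set" where
  "S = {A \<in> carrier_mat n n. (\<Sum>i<n. A $$ (i, i)) = 0 \<and> (\<forall>i<n. \<forall>j<n. \<not> R i j \<longrightarrow> A $$ (i, j) = 0)}"

abbreviation V :: "('k::field_char_0, 'k mat) module" where
  "V \<equiv> (module_mat TYPE('k) n n)\<lparr>carrier := S\<rparr>"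

lemma S_carrier: "A \<in> S \<Longrightarrow> A \<in> carrier_mat n n" by (simp add: S_def)

lemma entries_pattern: "A \<in> S \<Longrightarrow> entries n A \<in> pattern_algebra {..<n} R"
  by (auto simp: S_def entries_def pattern_algebra_def split: if_splits)

lemma S_zero: "0\<^sub>m n n \<in> S" by (simp add: S_def)

lemma S_add: "A \<in> S \<Longrightarrow> B \<in> S \<Longrightarrow> A + B \<in> S"
  by (auto simp: S_def sum.distrib)

lemma S_smult: "A \<in> S \<Longrightarrow> c \<cdot>\<^sub>m A \<in> S"
  by (auto simp: S_def sum_distrib_left[symmetric])

lemma mprod_pattern:
  assumes "A \<in> S" "B \<in> S"
  shows "mprod {..<n} (entries n A) (entries n B) \<in> pattern_algebra {..<n} R"
proof (rule mprod_in_pattern_algebra[OF assms[THEN entries_pattern]])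
  fix i j k assume "i \<in> {..<n}" "j \<in> {..<n}" "k \<in> {..<n}" "R i j" "R j k"
  then show "R i k" using trans[of i j k] by simp
qed

lemma S_commutator:
  fixes A B :: "'k::field_char_0 mat"
  assumes A: "A \<in> S" and B: "B \<in> S"
  shows "commutator A B \<in> S"
proof -
  note carrier = S_carrier[OF A] S_carrier[OF B]
  have ent: "commutator A B $$ (i, j) =
      mprod {..<n} (entries n A) (entries n B) i j - mprod {..<n} (entries n B) (entries n A) i j"
    if "i < n" "j < n" for i j
    using entries_mult[OF carrier(1,2) that] entries_mult[OF carrier(2,1) that] carrier that
    by (simp add: commutator_def entries_def)
  have "(\<Sum>i<n. mprod {..<n} (entries n A) (entries n B) i i) =
      (\<Sum>i<n. mprod {..<n} (entries n B) (entries n A) i i)"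
    unfolding mprod_def by (subst sum.swap) (simp add: mult.commute)
  then have "(\<Sum>i<n. commutator A B $$ (i, i)) = 0"
    using ent by (simp add: sum_subtractf)
  moreover have "mprod {..<n} (entries n A) (entries n B) i j = 0"
    "mprod {..<n} (entries n B) (entries n A) i j = 0" if "\<not> R i j" for i j
    using mprod_pattern[OF A B] mprod_pattern[OF B A] that by (auto simp: pattern_algebra_def)
  ultimately show ?thesis
    using commutator_carrier[OF carrier] ent by (simp add: S_def)
qed

text \<open>The matrix unit at \<open>(i, j)\<close>, made traceless by subtracting a scalar matrix.\<close>

definition unit_matrix :: "nat \<Rightarrow> nat \<Rightarrow> 'k::field_char_0 mat" where
  "unit_matrix i j = mat n n (\<lambda>(a, b).
     (if a = i \<and> b = j then 1 else 0) - (if i = j \<and> a = b then 1 / of_nat n else 0))"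

lemma unit_matrix_S:
  assumes "i < n" "j < n" "R i j"
  shows "(unit_matrix i j :: 'k::field_char_0 mat) \<in> S"
proof -
  have "(\<Sum>a<n. (if a = i \<and> a = j then 1 else 0 :: 'k)) = (if i = j then 1 else 0)"
    using assms by (auto simp: sum.If_cases intro!: sum.neutral)
  then have "(\<Sum>a<n. (unit_matrix i j :: 'k mat) $$ (a, a)) = 0"
    using n_pos by (simp add: unit_matrix_def sum_subtractf)
  then show ?thesis
    using assms refl by (auto simp: S_def unit_matrix_def)
qed

text \<open>A traceless matrix is the combination of the corrected matrix units with its own entries as
  coefficients, because the corrections add up to a multiple of its trace.\<close>

lemma linear_form_pairing:
  fixes f :: "'k::field_char_0 mat \<Rightarrow> 'k"
  assumes f: "f \<in> linear_forms V"
  shows "\<exists>F. \<forall>A\<in>S. f A = pairing n F A"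
proof -
  have f_add: "f (x + y) = f x + f y" if "x \<in> S" "y \<in> S" for x y
    using f that by (simp add: linear_forms_def module_mat_simps)
  have f_smult: "f (c \<cdot>\<^sub>m x) = c * f x" if "x \<in> S" for x c
    using f that by (simp add: linear_forms_def module_mat_simps)
  have f_0: "f (0\<^sub>m n n) = 0"
    using f_smult[OF S_zero, of 0] by (metis S_carrier S_zero mult_zero_left smult_zero_mat)
  define F where "F j i = (if R i j then f (unit_matrix i j) else 0)" for j i
  have "f A = pairing n F A" if A: "A \<in> S" for A
  proof -
    define B where "B P = mat n n (\<lambda>(a, b). \<Sum>(i, j)\<in>P. A $$ (i, j) * unit_matrix i j $$ (a, b))" for P
    have main: "B P \<in> S \<and> f (B P) = (\<Sum>(i, j)\<in>P. A $$ (i, j) * F j i)"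
      if "finite P" "P \<subseteq> {(i, j). i < n \<and> j < n \<and> R i j}" for P
      using that
    proof (induction P)
      case empty
      have "B {} = 0\<^sub>m n n" by (intro eq_matI) (auto simp: B_def)
      then show ?case using f_0 S_zero by simp
    next
      case (insert e P)
      obtain i j where e: "e = (i, j)" by force
      have ij: "i < n" "j < n" "R i j" using insert e by auto
      have IH: "B P \<in> S" "f (B P) = (\<Sum>(i, j)\<in>P. A $$ (i, j) * F j i)" using insert by auto
      have "B (insert e P) = A $$ (i, j) \<cdot>\<^sub>m unit_matrix i j + B P"
        using insert e by (intro eq_matI) (auto simp: B_def unit_matrix_def)
      moreover have U: "(unit_matrix i j :: 'k mat) \<in> S" by (rule unit_matrix_S[OF ij])
      ultimately have "B (insert e P) \<in> S" "f (B (insert e P)) = A $$ (i, j) * f (unit_matrix i j) + f (B P)"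
        using IH(1) by (simp_all add: S_add S_smult f_add f_smult)
      then show ?case using IH(2) insert e ij by (simp add: F_def)
    qed
    let ?P = "{(i, j). i < n \<and> j < n \<and> R i j}"
    have P: "?P \<subseteq> {..<n} \<times> {..<n}" by auto
    have finP: "finite ?P" using finite_subset[OF P] by simp
    have sumP: "(\<Sum>(i, j)\<in>?P. A $$ (i, j) * g i j) = (\<Sum>i<n. \<Sum>j<n. A $$ (i, j) * g i j)"
      for g :: "nat \<Rightarrow> nat \<Rightarrow> 'k"
      unfolding sum.cartesian_product using A P
      by (intro sum.mono_neutral_left) (auto simp: S_def)
    have "B ?P = A"
    proof (intro eq_matI)
      fix a b assume "a < dim_row A" "b < dim_col A"
      then have ab: "a < n" "b < n" using S_carrier[OF A] by auto
      have "B ?P $$ (a, b) = (\<Sum>i<n. \<Sum>j<n. A $$ (i, j) *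
          ((if a = i \<and> b = j then 1 else 0) - (if i = j \<and> a = b then 1 / of_nat n else 0)))"
        using ab sumP by (simp add: B_def unit_matrix_def)
      also have "\<dots> = (\<Sum>i<n. \<Sum>j<n. A $$ (i, j) * (if i = a \<and> j = b then 1 else 0)) -
          (\<Sum>i<n. \<Sum>j<n. A $$ (i, j) * (if i = j then (if a = b then 1 / of_nat n else 0) else 0))"
        unfolding sum_subtractf[symmetric]
        by (intro sum.cong HOL.refl) (auto simp: right_diff_distrib)
      also have "\<dots> = A $$ (a, b) - (\<Sum>i<n. A $$ (i, i)) * (if a = b then 1 / of_nat n else 0)"
        unfolding sum_unit[OF ab] sum_diagonal sum_distrib_right ..
      also have "\<dots> = A $$ (a, b)" using A by (simp add: S_def)
      finally show "B ?P $$ (a, b) = A $$ (a, b)" .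
    qed (use S_carrier[OF A] in \<open>auto simp: B_def\<close>)
    then have "f A = (\<Sum>(i, j)\<in>?P. A $$ (i, j) * F j i)" using main[OF finP] by simp
    also have "\<dots> = pairing n F A" unfolding sumP pairing_def
      by (intro sum.cong HOL.refl) (simp add: entries_def)
    finally show ?thesis .
  qed
  then show ?thesis by blast
qed

lemma pairing_linear_form: "pairing n F \<in> linear_forms V"
  by (simp add: linear_forms_def module_mat_simps pairing_add pairing_smult S_carrier)

text \<open>Testing against the corrected matrix units is the same as testing against the matrix units, since
  the correction is a scalar matrix and pairs to zero with every commutator.\<close>

lemma kernel_iff_stabilizer:
  fixes A :: "'k::field_char_0 mat"
  assumes A: "A \<in> S"
  shows "(\<forall>B\<in>S. pairing n F (commutator A B) = 0) \<longleftrightarrow> entries n A \<in> stabilizer {..<n} R F"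
proof
  let ?D = "\<lambda>j i. mprod {..<n} F (entries n A) j i - mprod {..<n} (entries n A) F j i"
  have pc: "pairing n F (commutator A B) = (\<Sum>i<n. \<Sum>j<n. ?D j i * entries n B i j)" if "B \<in> S" for B
    using pairing_commutator S_carrier A that by blast
  {
    assume 0: "\<forall>B\<in>S. pairing n F (commutator A B) = 0"
    have trD: "(\<Sum>i<n. ?D i i) = 0"
    proof -
      have "(\<Sum>i<n. mprod {..<n} F (entries n A) i i) = (\<Sum>i<n. mprod {..<n} (entries n A) F i i)"
        unfolding mprod_def by (subst sum.swap) (simp add: mult.commute)
      then show ?thesis by (simp add: sum_subtractf)
    qed
    have "?D j i = 0" if ij: "i < n" "j < n" "R i j" for i j
    proof -
      have "0 = (\<Sum>a<n. \<Sum>b<n. ?D b a * entries n (unit_matrix i j) a b)"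
        using 0 pc[OF unit_matrix_S[OF ij]] unit_matrix_S[OF ij, where 'k = 'k] by simp
      also have "\<dots> = (\<Sum>a<n. \<Sum>b<n. ?D b a * (if a = i \<and> b = j then 1 else 0)) -
          (\<Sum>a<n. \<Sum>b<n. ?D b a * (if a = b then (if i = j then 1 / of_nat n else 0) else 0))"
        unfolding sum_subtractf[symmetric]
        by (intro sum.cong HOL.refl) (simp add: entries_def unit_matrix_def right_diff_distrib)
      also have "\<dots> = ?D j i - (\<Sum>a<n. ?D a a) * (if i = j then 1 / of_nat n else 0)"
        unfolding sum_unit[OF ij(1,2)] sum_diagonal sum_distrib_right ..
      finally show ?thesis using trD by simp
    qed
    then show "entries n A \<in> stabilizer {..<n} R F"
      using entries_pattern[OF A] by (auto simp: stabilizer_def)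
  next
    assume st: "entries n A \<in> stabilizer {..<n} R F"
    show "\<forall>B\<in>S. pairing n F (commutator A B) = 0"
    proof
      fix B :: "'k mat" assume B: "B \<in> S"
      have "?D j i * entries n B i j = 0" if "i < n" "j < n" for i j
        using st pattern_algebraD(3)[OF entries_pattern[OF B], of i j] that
        by (cases "entries n B i j = 0") (auto simp: stabilizer_def)
      then show "pairing n F (commutator A B) = 0"
        unfolding pc[OF B] by (intro sum.neutral ballI) (simp only: lessThan_iff)
    qed
  }
qed

definition kernel :: "('k::field_char_0 mat \<Rightarrow> 'k) \<Rightarrow> 'k mat set" where
  "kernel f = {A \<in> S. \<forall>B\<in>S. f (commutator A B) = 0}"

text \<open>In characteristic zero, every matrix is the sum of a traceless one and a scalar one, and zero is the
  only matrix that is both.\<close>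

lemma kernel_trivial_iff_frobenius_form:
  fixes F :: "nat \<Rightarrow> nat \<Rightarrow> 'k::field_char_0"
  shows "kernel (pairing n F) = {0\<^sub>m n n} \<longleftrightarrow> frobenius_form {..<n} R F"
proof
  assume triv: "kernel (pairing n F) = {0\<^sub>m n n}"
  show "frobenius_form {..<n} R F"
    unfolding frobenius_form_def
  proof
    fix x assume x: "x \<in> stabilizer {..<n} R F"
    define c where "c = (\<Sum>i<n. x i i) / of_nat n"
    define A where "A = mat n n (\<lambda>(i, j). x i j - (if i = j then c else 0))"
    have xp: "x \<in> pattern_algebra {..<n} R" using x by (simp add: stabilizer_def)
    have "(\<Sum>i<n. A $$ (i, i)) = 0"
      using n_pos by (simp add: A_def sum_subtractf c_def)
    then have A: "A \<in> S"
      using pattern_algebra_zero[OF xp] refl by (auto simp: S_def A_def)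
    have eA: "entries n A i j = x i j - c * identity_on {..<n} i j" for i j
      using pattern_algebra_zero[OF xp, of i j] by (auto simp: entries_def A_def identity_on_def)
    have "mprod {..<n} F (entries n A) j i = mprod {..<n} F x j i - c * F j i"
      "mprod {..<n} (entries n A) F j i = mprod {..<n} x F j i - c * F j i" if "i < n" "j < n" for i j
    proof -
      have "mprod {..<n} F (entries n A) j i = mprod {..<n} F x j i - c * mprod {..<n} F (identity_on {..<n}) j i"
        by (simp add: mprod_def eA algebra_simps sum_subtractf sum_distrib_left)
      then show "mprod {..<n} F (entries n A) j i = mprod {..<n} F x j i - c * F j i"
        using that by (simp add: mprod_identity)
      have "mprod {..<n} (entries n A) F j i = mprod {..<n} x F j i - c * mprod {..<n} (identity_on {..<n}) F j i"
        by (simp add: mprod_def eA algebra_simps sum_subtractf sum_distrib_left)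
      then show "mprod {..<n} (entries n A) F j i = mprod {..<n} x F j i - c * F j i"
        using that by (simp add: mprod_identity)
    qed
    then have "entries n A \<in> stabilizer {..<n} R F"
      using x entries_pattern[OF A] by (simp add: stabilizer_def)
    then have "A \<in> kernel (pairing n F)"
      using A kernel_iff_stabilizer[OF A] by (simp add: kernel_def)
    then have "A = 0\<^sub>m n n" using triv by blast
    then have "x i j = (if i = j then c else 0)" if "i < n" "j < n" for i j
      using eA[of i j] that by (simp add: entries_def identity_on_def)
    then show "scalar_on {..<n} x" by (auto simp: scalar_on_def)
  qed
next
  assume fr: "frobenius_form {..<n} R F"
  have "A = 0\<^sub>m n n" if A: "A \<in> kernel (pairing n F)" for A
  proof -
    have AS: "A \<in> S" using A by (simp add: kernel_def)
    then have "entries n A \<in> stabilizer {..<n} R F"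
      using A kernel_iff_stabilizer by (auto simp: kernel_def)
    then obtain c where c: "\<And>i j. i < n \<Longrightarrow> j < n \<Longrightarrow> entries n A i j = (if i = j then c else 0)"
      using fr by (auto simp: frobenius_form_def scalar_on_def)
    have e: "A $$ (i, j) = (if i = j then c else 0)" if "i < n" "j < n" for i j
      using c[OF that] that by (simp add: entries_def)
    have "(\<Sum>i<n. A $$ (i, i)) = of_nat n * c" using e by simp
    then have "c = 0" using AS n_pos by (simp add: S_def)
    then show ?thesis using e S_carrier[OF AS] by (intro eq_matI) auto
  qed
  moreover have "0\<^sub>m n n \<in> kernel (pairing n F)"
    using S_zero by (simp add: kernel_def pairing_commutator_zero S_carrier)
  ultimately show "kernel (pairing n F) = {0\<^sub>m n n}" by blast
qed

text \<open>The minimum of the kernel dimensions is attained, and every linear form has the kernel of some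
  \<open>pairing n F\<close>.\<close>

lemma lie_index_eq_0_iff:
  "lie_index (V :: ('k::field_char_0, 'k mat) module) commutator = 0 \<longleftrightarrow>
     frobenius_pattern TYPE('k) {..<n} R"
proof -
  let ?V = "V :: ('k, 'k mat) module"
  have K: "?V\<lparr>carrier := {x \<in> carrier ?V. \<forall>y\<in>carrier ?V. f (commutator x y) = 0}\<rparr> =
      (module_mat TYPE('k) n n)\<lparr>carrier := kernel f\<rparr>" for f
    by (simp add: kernel_def)
  have dim0: "vectorspace.dim class_ring ((module_mat TYPE('k) n n)\<lparr>carrier := kernel (pairing n F)\<rparr>) = 0
      \<longleftrightarrow> kernel (pairing n F) = {0\<^sub>m n n}" for F :: "nat \<Rightarrow> nat \<Rightarrow> 'k"
  proof (rule subspace_matrices_dim_eq_0_iff)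
    show "kernel (pairing n F) \<subseteq> carrier_mat n n" using S_carrier by (auto simp: kernel_def)
    show "0\<^sub>m n n \<in> kernel (pairing n F)"
      using S_zero by (simp add: kernel_def pairing_commutator_zero S_carrier)
    have comm: "commutator (x + y) z = commutator x z + commutator y z"
      "commutator (c \<cdot>\<^sub>m x) z = c \<cdot>\<^sub>m commutator x z"
      if "x \<in> carrier_mat n n" "y \<in> carrier_mat n n" "z \<in> carrier_mat n n" for x y z :: "'k mat" and c
      using that by (auto simp: commutator_def add_mult_distrib_mat mult_add_distrib_mat algebra_simps
          intro!: eq_matI)
    show "x + y \<in> kernel (pairing n F)" if "x \<in> kernel (pairing n F)" "y \<in> kernel (pairing n F)" for x y
      using that by (simp add: kernel_def S_add S_carrier comm pairing_add commutator_carrier)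
    show "c \<cdot>\<^sub>m x \<in> kernel (pairing n F)" if "x \<in> kernel (pairing n F)" for x c
      using that comm(2)[of x x]
      by (simp add: kernel_def S_smult S_carrier pairing_smult commutator_carrier)
  qed
  have pair: "\<exists>F. kernel f = kernel (pairing n F)" if f: "f \<in> linear_forms ?V" for f
  proof -
    obtain F where F: "\<forall>A\<in>S. f A = pairing n F A" using linear_form_pairing[OF f] by blast
    have "f (commutator A B) = pairing n F (commutator A B)" if "A \<in> S" "B \<in> S" for A B
      using F S_commutator[OF that] by blast
    then have "kernel f = kernel (pairing n F)" by (auto simp: kernel_def)
    then show ?thesis by blast
  qed
  let ?P = "\<lambda>d. \<exists>f\<in>linear_forms ?V.
     d = vectorspace.dim class_ring ((module_mat TYPE('k) n n)\<lparr>carrier := kernel f\<rparr>)"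
  have "lie_index ?V commutator = (LEAST d. ?P d)" unfolding lie_index_def K ..
  also have "(LEAST d. ?P d) = 0 \<longleftrightarrow> ?P 0"
  proof
    assume 0: "(LEAST d. ?P d) = 0"
    have "\<exists>d. ?P d" using pairing_linear_form by blast
    then have "?P (LEAST d. ?P d)" by (rule LeastI_ex)
    then show "?P 0" by (simp only: 0)
  qed (rule Least_eq_0)
  also have "?P 0 \<longleftrightarrow> (\<exists>F :: nat \<Rightarrow> nat \<Rightarrow> 'k. kernel (pairing n F) = {0\<^sub>m n n})"
    using pair dim0 pairing_linear_form by metis
  finally show ?thesis
    by (simp add: kernel_trivial_iff_frobenius_form frobenius_pattern_def)
qed

end

lemma comp_pair_lists:
  "plus_part a \<noteq> []" "minus_part a \<noteq> []" "\<forall>x\<in>set (plus_part a). 0 < x" "\<forall>x\<in>set (minus_part a). 0 < x"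
  "sum_list (minus_part a) = sum_list (plus_part a)" "0 < sum_list (plus_part a)"
  by (transfer, auto simp: compositions_def)+

theorem frobenius_pairs_iff:
  "a \<in> frobenius_pairs TYPE('k::field_char_0) \<longleftrightarrow>
     frobenius_seaweed TYPE('k) (plus_part a) (minus_part a)"
proof -
  let ?p = "plus_part a" and ?q = "minus_part a"
  interpret traceless_pattern "sum_list ?p" "seaweed_rel ?p ?q"
    by unfold_locales (use comp_pair_lists(6) in \<open>auto simp: seaweed_rel_def\<close>)
  have "(seaweed a :: 'k mat set) = S"
  proof (intro equalityI subsetI)
    fix A :: "'k mat" assume "A \<in> seaweed a"
    then show "A \<in> S"
      by (auto simp: seaweed_def parabolic_def S_def seaweed_rel_def comp_pair_lists(5) not_le)
  next
    fix A :: "'k mat" assume A: "A \<in> S"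
    then have "transpose_mat A \<in> parabolic ?q"
      by (auto simp: parabolic_def S_def seaweed_rel_def comp_pair_lists(5) not_le)
    then have "A \<in> transpose_mat ` parabolic ?q" by (metis image_eqI transpose_transpose)
    moreover have "A \<in> parabolic ?p"
      using A by (auto simp: parabolic_def S_def seaweed_rel_def not_le)
    ultimately show "A \<in> seaweed a" by (simp add: seaweed_def)
  qed
  then show ?thesis
    using lie_index_eq_0_iff[where 'k = 'k]
    by (simp add: frobenius_pairs_def seaweed_space_def pair_size_def frobenius_seaweed_def)
qed

section \<open>Pairs of compositions and words in the operators\<close>

lemma comp_pair_eqI:
  assumes "plus_part a = plus_part b" "minus_part a = minus_part b"
  shows "a = b"
  using assms by transfer (auto simp: prod_eq_iff)

lemma comp_pair_exists:
  assumes "p \<noteq> []" "q \<noteq> []" "\<forall>x\<in>set p. 0 < x" "\<forall>x\<in>set q. 0 < x" "sum_list p = sum_list q"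
  shows "\<exists>a. plus_part a = p \<and> minus_part a = q"
proof -
  have "0 < sum_list p" using assms by (cases p) auto
  then have "(p, q) \<in> (\<Union>n\<in>{1..}. compositions n \<times> compositions n)"
    using assms by (auto simp: compositions_def intro!: bexI[of _ "sum_list p"])
  then show ?thesis
    by (intro exI[of _ "Abs_comp_pair (p, q)"])
      (simp add: plus_part.rep_eq minus_part.rep_eq Abs_comp_pair_inverse)
qed

lemma parts_simps [simp]:
  "plus_part (swap_pair a) = minus_part a" "minus_part (swap_pair a) = plus_part a"
  "plus_part unit_pair = [1]" "minus_part unit_pair = [1]"
  "plus_part (sigma_pair m a) = ((m + 2) * hd (plus_part a)) # tl (plus_part a)"
  "minus_part (sigma_pair m a) = ((m + 1) * hd (plus_part a)) # minus_part a"
  by (transfer, auto split: prod.splits)+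

lemma tau_parts:
  assumes "plus_part a = x # y # p"
  shows "plus_part (tau_pair m a) = ((m + 1) * x + (m + 2) * y) # p"
    and "minus_part (tau_pair m a) = (m * x + (m + 1) * y) # minus_part a"
  using assms by (transfer, auto)+

lemma swap_swap [simp]: "swap_pair (swap_pair a) = a"
  by (rule comp_pair_eqI) simp_all

text \<open>The operators acting on the plus part; the others are their conjugates under \<open>rho\<close>.\<close>

definition plus_generators :: "(cbar \<Rightarrow> cbar) set" where
  "plus_generators = range sigma_plus \<union> range tau_plus"

lemma generators_eq: "generators = plus_generators \<union> (\<lambda>g. rho \<circ> g \<circ> rho) ` plus_generators"
  by (auto simp: generators_def plus_generators_def sigma_minus_def[abs_def] tau_minus_def[abs_def])

lemma plus_generator_cases:
  assumes "g \<in> plus_generators" "g (Some a) = Some c"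
  obtains (sigma) m k p where "g = sigma_plus m" "0 < k" "plus_part a = k # p"
      "plus_part c = ((m + 2) * k) # p" "minus_part c = ((m + 1) * k) # minus_part a"
      "k + sum_list p = sum_list (minus_part a)"
  | (tau) m x y p where "g = tau_plus m" "0 < x" "0 < y" "plus_part a = x # y # p"
      "plus_part c = ((m + 1) * x + (m + 2) * y) # p" "minus_part c = (m * x + (m + 1) * y) # minus_part a"
      "x + y + sum_list p = sum_list (minus_part a)"
proof -
  note ca = comp_pair_lists[of a]
  consider m where "g = sigma_plus m" | m where "g = tau_plus m"
    using assms by (auto simp: plus_generators_def)
  then show thesis
  proof cases
    case 1
    obtain k p where kp: "plus_part a = k # p" using ca(1) by (cases "plus_part a") auto
    have "c = sigma_pair m a" using assms 1 by (simp add: sigma_plus_def)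
    then show thesis using sigma[of m k p] 1 kp ca by simp
  next
    case 2
    have len: "length (plus_part a) > 1" and c: "c = tau_pair m a"
      using assms 2 by (auto simp: tau_plus_def split: if_splits)
    then obtain x y p where xyp: "plus_part a = x # y # p"
      by (cases "plus_part a"; cases "tl (plus_part a)") auto
    show thesis using tau[of m x y p] 2 xyp ca c tau_parts[OF xyp] by simp
  qed
qed

text \<open>The larger first part shows on which side the last operator acted.\<close>

lemma plus_generator_first_parts:
  assumes "g \<in> plus_generators" "g (Some a) = Some c"
  shows "hd (minus_part c) < hd (plus_part c)"
  using assms by (cases rule: plus_generator_cases) auto

lemma generator_first_parts:
  assumes "g \<in> generators" "g (Some a) = Some c"
  shows "hd (minus_part c) \<noteq> hd (plus_part c)"
proof (cases "g \<in> plus_generators")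
  case True
  then show ?thesis using plus_generator_first_parts assms by fastforce
next
  case False
  then obtain h where h: "h \<in> plus_generators" "g = rho \<circ> h \<circ> rho"
    using assms generators_eq by blast
  then obtain d where "h (Some (swap_pair a)) = Some d" "c = swap_pair d"
    using assms by (auto simp: rho_def)
  then show ?thesis using plus_generator_first_parts[OF h(1)] by fastforce
qed

text \<open>The parameters of an operator are recovered from the first parts \<open>s > t\<close> of its value by dividing
  \<open>t\<close> by \<open>s - t\<close>.\<close>

lemma sigma_tau_division:
  fixes m :: nat
  shows "(m + 2) * k - (m + 1) * k = k" "((m + 1) * k) mod k = 0" "0 < k \<Longrightarrow> ((m + 1) * k) div k = m + 1"
    and "((m + 1) * x + (m + 2) * y) - (m * x + (m + 1) * y) = x + y"
    and "0 < x \<Longrightarrow> (m * x + (m + 1) * y) mod (x + y) = y"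
    and "0 < x \<Longrightarrow> (m * x + (m + 1) * y) div (x + y) = m"
proof -
  show "(m + 2) * k - (m + 1) * k = k" by simp
  show "((m + 1) * k) mod k = 0" by simp
  show "((m + 1) * k) div k = m + 1" if "0 < k" using that by simp
  show "((m + 1) * x + (m + 2) * y) - (m * x + (m + 1) * y) = x + y" by simp
  have e: "m * x + (m + 1) * y = y + m * (x + y)" by (simp add: algebra_simps)
  show "(m * x + (m + 1) * y) mod (x + y) = y" if "0 < x" unfolding e using that by simp
  show "(m * x + (m + 1) * y) div (x + y) = m" if "0 < x" unfolding e using that by simp
qed

lemma plus_generator_inject:
  assumes g: "g \<in> plus_generators" "g (Some a) = Some c"
    and h: "h \<in> plus_generators" "h (Some b) = Some c"
  shows "g = h \<and> a = b"
  using g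
proof (cases rule: plus_generator_cases)
  case 1: (sigma m k p)
  from h show ?thesis
  proof (cases rule: plus_generator_cases)
    case 2: (sigma m' k' p')
    have st: "(m + 2) * k = (m' + 2) * k'" "(m + 1) * k = (m' + 1) * k'"
      using 1 2 by (metis list.sel(1))+
    have k: "k = k'"
      using sigma_tau_division(1)[of m k] sigma_tau_division(1)[of m' k'] unfolding st by simp
    have "m + 1 = m' + 1"
      using st(2) k 2(2) by simp
    then show ?thesis using 1 2 k by (auto intro: comp_pair_eqI)
  next
    case 2: (tau m' x y p')
    have st: "(m + 2) * k = (m' + 1) * x + (m' + 2) * y" "(m + 1) * k = m' * x + (m' + 1) * y"
      using 1 2 by (metis list.sel(1))+
    have "k = x + y"
      using sigma_tau_division(1)[of m k] sigma_tau_division(4)[of m' x y] unfolding st by simp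
    then have "y = 0"
      using sigma_tau_division(2)[of m k] sigma_tau_division(5)[OF 2(2), of m' y] unfolding st by simp
    then show ?thesis using 2 by simp
  qed
next
  case 1: (tau m x y p)
  from h show ?thesis
  proof (cases rule: plus_generator_cases)
    case 2: (sigma m' k' p')
    have st: "(m' + 2) * k' = (m + 1) * x + (m + 2) * y" "(m' + 1) * k' = m * x + (m + 1) * y"
      using 1 2 by (metis list.sel(1))+
    have "k' = x + y"
      using sigma_tau_division(1)[of m' k'] sigma_tau_division(4)[of m x y] unfolding st by simp
    then have "y = 0"
      using sigma_tau_division(2)[of m' k'] sigma_tau_division(5)[OF 1(2), of m y] unfolding st by simp
    then show ?thesis using 1 by simp
  next
    case 2: (tau m' x' y' p')
    have st: "(m + 1) * x + (m + 2) * y = (m' + 1) * x' + (m' + 2) * y'"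
      "m * x + (m + 1) * y = m' * x' + (m' + 1) * y'"
      using 1 2 by (metis list.sel(1))+
    have d: "x + y = x' + y'"
      using sigma_tau_division(4)[of m x y] sigma_tau_division(4)[of m' x' y'] unfolding st by simp
    have y: "y = y'"
      using sigma_tau_division(5)[OF 1(2), of m y] sigma_tau_division(5)[OF 2(2), of m' y'] unfolding st d by simp
    have "m = m'"
      using sigma_tau_division(6)[OF 1(2), of m y] sigma_tau_division(6)[OF 2(2), of m' y'] unfolding st d by simp
    then show ?thesis using 1 2 d y by (auto intro: comp_pair_eqI)
  qed
qed

lemma rho_Some [simp]: "rho (Some a) = Some (swap_pair a)" "rho None = None"
  by (simp_all add: rho_def)

lemma rho_eq_Some_iff: "rho x = Some c \<longleftrightarrow> x = Some (swap_pair c)"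
  by (cases x) (auto simp: rho_def)

text \<open>Comparing the first parts tells the operators on the plus part from those on the minus part, and
  conjugation by \<open>rho\<close> reduces the latter to the former.\<close>

lemma generator_inject:
  assumes g: "g \<in> generators" "g (Some a) = Some c"
    and h: "h \<in> generators" "h (Some b) = Some c"
  shows "g = h \<and> a = b"
proof -
  have minus: "\<exists>g'. g' \<in> plus_generators \<and> g = rho \<circ> g' \<circ> rho \<and> g' (Some (swap_pair a)) = Some (swap_pair c)
      \<and> hd (plus_part c) < hd (minus_part c)"
    if g1: "g \<in> generators" "g \<notin> plus_generators" and g2: "g (Some a) = Some c" for g a
  proof -
    obtain g' where g': "g' \<in> plus_generators" "g = rho \<circ> g' \<circ> rho"
      using g1 unfolding generators_eq by blast
    then have "g' (Some (swap_pair a)) = Some (swap_pair c)"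
      using g2 by (simp add: rho_eq_Some_iff)
    then show ?thesis
      using g' plus_generator_first_parts[of g' "swap_pair a" "swap_pair c"]
      by (intro exI[of _ g']) simp
  qed
  show ?thesis
  proof (cases "g \<in> plus_generators")
    case True
    then have "hd (minus_part c) < hd (plus_part c)" using plus_generator_first_parts[of g a c] g(2) by simp
    then have "h \<in> plus_generators" using minus[of h b] h by auto
    then show ?thesis using plus_generator_inject[of g a c h b] True g(2) h(2) by simp
  next
    case False
    then obtain g' where g': "g' \<in> plus_generators" "g = rho \<circ> g' \<circ> rho"
        "g' (Some (swap_pair a)) = Some (swap_pair c)" and lt: "hd (plus_part c) < hd (minus_part c)"
      using minus[of g a] g by auto
    have "h \<notin> plus_generators"
      using plus_generator_first_parts[of h b c] h(2) lt by auto
    then obtain h' where h': "h' \<in> plus_generators" "h = rho \<circ> h' \<circ> rho"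
        "h' (Some (swap_pair b)) = Some (swap_pair c)"
      using minus[of h b] h by auto
    have "g' = h' \<and> swap_pair a = swap_pair b"
      by (rule plus_generator_inject[OF g'(1,3) h'(1,3)])
    then show ?thesis using g'(2) h'(2) swap_swap by metis
  qed
qed

lemma generator_None: "g \<in> generators \<Longrightarrow> g None = None"
  by (auto simp: generators_def sigma_plus_def tau_plus_def sigma_minus_def tau_minus_def rho_def)

definition frobenius_pair :: "'k::field itself \<Rightarrow> comp_pair \<Rightarrow> bool" where
  "frobenius_pair K a \<longleftrightarrow> frobenius_seaweed K (plus_part a) (minus_part a)"

lemma frobenius_pair_swap [simp]:
  "frobenius_pair TYPE('k::field) (swap_pair a) \<longleftrightarrow> frobenius_pair TYPE('k) a"
  using frobenius_seaweed_swap comp_pair_lists(5)[of a] by (auto simp: frobenius_pair_def)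

lemma plus_generator_frobenius_pair:
  assumes "g \<in> plus_generators" "g (Some a) = Some c"
  shows "frobenius_pair TYPE('k::field) c \<longleftrightarrow> frobenius_pair TYPE('k) a"
  using assms
proof (cases rule: plus_generator_cases)
  case (sigma m k p)
  then show ?thesis unfolding frobenius_pair_def
    using frobenius_seaweed_sigma[of k p "minus_part a" m, where 'k = 'k] by simp
next
  case (tau m x y p)
  then show ?thesis unfolding frobenius_pair_def
    using frobenius_seaweed_tau[of x y p "minus_part a" m, where 'k = 'k] by simp
qed

lemma generator_frobenius_pair:
  assumes "g \<in> generators" "g (Some a) = Some c"
  shows "frobenius_pair TYPE('k::field) c \<longleftrightarrow> frobenius_pair TYPE('k) a"
proof (cases "g \<in> plus_generators")
  case True
  then show ?thesis using plus_generator_frobenius_pair assms by blast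
next
  case False
  then obtain h where h: "h \<in> plus_generators" "g = rho \<circ> h \<circ> rho"
    using assms generators_eq by blast
  then have "h (Some (swap_pair a)) = Some (swap_pair c)"
    using assms by (simp add: rho_eq_Some_iff)
  from plus_generator_frobenius_pair[OF h(1) this, where 'k = 'k] show ?thesis by simp
qed

lemma sigma_or_tau:
  fixes s t :: nat
  assumes "t < s" "0 < t"
  shows "(\<exists>m k. 0 < k \<and> s = (m + 2) * k \<and> t = (m + 1) * k) \<or>
    (\<exists>m x y. 0 < x \<and> 0 < y \<and> s = (m + 1) * x + (m + 2) * y \<and> t = m * x + (m + 1) * y)"
proof -
  define d where "d = s - t"
  have d: "0 < d" "s = t + d" using assms by (auto simp: d_def)
  show ?thesis
  proof (cases "d dvd t")
    case True
    then obtain e where e: "t = d * e" by blast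
    then obtain m where "e = Suc m" using assms by (cases e) auto
    then have "s = (m + 2) * d \<and> t = (m + 1) * d" using e d by (simp add: algebra_simps)
    then show ?thesis using d by blast
  next
    case False
    define y where "y = t mod d"
    define x where "x = d - y"
    have y: "0 < y" "y < d" using False d by (auto simp: y_def mod_greater_zero_iff_not_dvd)
    have xy: "x + y = d" "0 < x" using y by (auto simp: x_def)
    have "t = (t div d) * d + y" by (simp add: y_def)
    then have "t = (t div d) * (x + y) + y" using xy(1) by simp
    then have "t = (t div d) * x + (t div d + 1) * y" by (simp add: algebra_simps)
    moreover from this have "s = (t div d + 1) * x + (t div d + 2) * y"
      using d xy by (simp add: algebra_simps)
    ultimately show ?thesis using xy y by blast
  qed
qed

lemma plus_generator_onto:
  assumes lt: "hd (minus_part c) < hd (plus_part c)"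
  shows "\<exists>g\<in>plus_generators. \<exists>a. g (Some a) = Some c \<and> pair_size a < pair_size c"
proof -
  note cc = comp_pair_lists[of c]
  obtain s p where sp: "plus_part c = s # p" using cc(1) by (cases "plus_part c") auto
  obtain t q where tq: "minus_part c = t # q" using cc(2) by (cases "minus_part c") auto
  have ts: "t < s" "0 < t" using lt sp tq cc by auto
  have sums: "s + sum_list p = t + sum_list q" using sp tq cc by simp
  have q: "q \<noteq> []" using sums ts by auto
  from sigma_or_tau[OF ts] show ?thesis
  proof (elim disjE exE conjE)
    fix m k assume k: "0 < k" "s = (m + 2) * k" "t = (m + 1) * k"
    then have "k + sum_list p = sum_list q" using sums by (simp add: algebra_simps)
    then obtain a where a: "plus_part a = k # p" "minus_part a = q"
      using comp_pair_exists[of "k # p" q] q k sp tq cc by auto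
    have "sigma_plus m (Some a) = Some c"
      using a k sp tq by (auto simp: sigma_plus_def intro!: comp_pair_eqI)
    moreover have "pair_size a < pair_size c"
      using comp_pair_lists(5)[of a] cc(5) a tq ts unfolding pair_size_def by simp
    ultimately show ?thesis by (auto simp: plus_generators_def)
  next
    fix m x y assume xy: "0 < x" "0 < y" "s = (m + 1) * x + (m + 2) * y" "t = m * x + (m + 1) * y"
    then have "x + y + sum_list p = sum_list q" using sums by (simp add: algebra_simps)
    then obtain a where a: "plus_part a = x # y # p" "minus_part a = q"
      using comp_pair_exists[of "x # y # p" q] q xy sp tq cc by auto
    have "tau_plus m (Some a) = Some c"
      using a xy sp tq tau_parts[OF a(1)] by (auto simp: tau_plus_def intro!: comp_pair_eqI)
    moreover have "pair_size a < pair_size c"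
      using comp_pair_lists(5)[of a] cc(5) a tq ts unfolding pair_size_def by simp
    ultimately show ?thesis by (auto simp: plus_generators_def)
  qed
qed

text \<open>The size decreases when the last operator is undone, so the peeling ends; it can only end at
  equal first parts.\<close>

lemma generator_onto:
  assumes fr: "frobenius_pair TYPE('k::field) c" and ne: "c \<noteq> unit_pair"
  shows "\<exists>g\<in>generators. \<exists>a. g (Some a) = Some c \<and> pair_size a < pair_size c"
proof -
  note cc = comp_pair_lists[of c]
  consider "hd (minus_part c) < hd (plus_part c)" | "hd (plus_part c) < hd (minus_part c)"
    | "hd (minus_part c) = hd (plus_part c)" by linarith
  then show ?thesis
  proof cases
    case 1
    then show ?thesis using plus_generator_onto generators_eq by blast
  next
    case 2
    then obtain g a where g: "g \<in> plus_generators" "g (Some a) = Some (swap_pair c)"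
      "pair_size a < pair_size (swap_pair c)"
      using plus_generator_onto[of "swap_pair c"] by auto
    have "pair_size (swap_pair b) = pair_size b" for b
      by (simp add: pair_size_def comp_pair_lists(5))
    moreover have "(rho \<circ> g \<circ> rho) (Some (swap_pair a)) = Some c" using g by simp
    moreover have "rho \<circ> g \<circ> rho \<in> generators" using g generators_eq by blast
    ultimately show ?thesis using g by metis
  next
    case 3
    obtain s p where sp: "plus_part c = s # p" using cc(1) by (cases "plus_part c") auto
    obtain q where q: "minus_part c = s # q" using cc(2) 3 sp by (cases "minus_part c") auto
    have "s = 1 \<and> p = [] \<and> q = []"
      using fr sp q cc by (intro frobenius_seaweed_equal_first_parts[where 'k = 'k]) (auto simp: frobenius_pair_def)
    then have "c = unit_pair" using sp q by (intro comp_pair_eqI) simp_all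
    then show ?thesis using ne by simp
  qed
qed

definition word_action :: "(cbar \<Rightarrow> cbar) list \<Rightarrow> cbar \<Rightarrow> cbar" where
  "word_action gs = foldr (\<circ>) gs id"

lemma word_action_simps [simp]:
  "word_action [] = id" "word_action (g # gs) = g \<circ> word_action gs"
  by (simp_all add: word_action_def)

lemma word_action_append: "word_action (gs @ hs) = word_action gs \<circ> word_action hs"
  by (induction gs) (simp_all add: comp_assoc)

lemma operator_monoid_eq: "operator_monoid = word_action ` lists generators"
proof (intro equalityI subsetI)
  fix w assume "w \<in> operator_monoid"
  then show "w \<in> word_action ` lists generators"
  proof induction
    case one
    have "id = word_action []" by simp
    then show ?case by (rule image_eqI) simp
  next
    case (gen g)
    have "g = word_action [g]" by simp
    then show ?case by (rule image_eqI) (simp add: gen)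
  next
    case (mult v w)
    then obtain gs hs where gh: "gs \<in> lists generators" "hs \<in> lists generators"
      "v = word_action gs" "w = word_action hs" by auto
    then have "v \<circ> w = word_action (gs @ hs)" by (simp add: word_action_append)
    then show ?case by (rule image_eqI) (use gh in simp)
  qed
next
  fix w assume "w \<in> word_action ` lists generators"
  then obtain gs where gs: "gs \<in> lists generators" "w = word_action gs" by blast
  from gs(1) have "word_action gs \<in> operator_monoid"
  proof induction
    case Nil
    show ?case unfolding word_action_simps by (rule operator_monoid.one)
  next
    case (Cons g gs)
    then show ?case unfolding word_action_simps
      by (intro operator_monoid.mult[OF operator_monoid.gen])
  qed
  then show "w \<in> operator_monoid" using gs by simp
qed

text \<open>The last letter is determined by the value, and the empty word is recognised by its value having
  equal first parts.\<close>

lemma word_action_inject: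
  assumes "gs \<in> lists generators" "hs \<in> lists generators"
    and "word_action gs (Some unit_pair) = Some c" "word_action hs (Some unit_pair) = Some c"
  shows "gs = hs"
  using assms
proof (induction gs arbitrary: hs c)
  case Nil
  have c: "c = unit_pair" using Nil by simp
  show ?case
  proof (cases hs)
    case (Cons h hs')
    then have h: "h \<in> generators" "h (word_action hs' (Some unit_pair)) = Some unit_pair"
      using Nil c by auto
    then obtain b where "h (Some b) = Some unit_pair"
      using generator_None[OF h(1)] by (cases "word_action hs' (Some unit_pair)") auto
    then show ?thesis using generator_first_parts[OF h(1)] by fastforce
  qed simp
next
  case (Cons g gs)
  have g: "g \<in> generators" "g (word_action gs (Some unit_pair)) = Some c" using Cons by auto
  then obtain a where a: "word_action gs (Some unit_pair) = Some a"
    using generator_None[OF g(1)] by (cases "word_action gs (Some unit_pair)") auto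
  show ?case
  proof (cases hs)
    case Nil
    then have "c = unit_pair" using Cons by simp
    then show ?thesis using generator_first_parts[of g a] g a by fastforce
  next
    case hs: (Cons h hs')
    have h: "h \<in> generators" "h (word_action hs' (Some unit_pair)) = Some c" using Cons hs by auto
    then obtain b where b: "word_action hs' (Some unit_pair) = Some b"
      using generator_None[OF h(1)] by (cases "word_action hs' (Some unit_pair)") auto
    have "g = h \<and> a = b" using generator_inject g h a b by simp
    then show ?thesis using Cons.IH[of hs' a] Cons.prems a b hs by simp
  qed
qed

lemma word_action_frobenius:
  assumes "gs \<in> lists generators" "word_action gs (Some unit_pair) = Some c"
  shows "frobenius_pair TYPE('k::field) c"
  using assms
proof (induction gs arbitrary: c)
  case Nil
  then show ?case using frobenius_seaweed_unit[where 'k = 'k] by (simp add: frobenius_pair_def)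
next
  case (Cons g gs)
  have g: "g \<in> generators" "g (word_action gs (Some unit_pair)) = Some c" using Cons by auto
  then obtain a where a: "word_action gs (Some unit_pair) = Some a"
    using generator_None[OF g(1)] by (cases "word_action gs (Some unit_pair)") auto
  then show ?case using Cons g generator_frobenius_pair[of g a c, where 'k = 'k] by auto
qed

lemma frobenius_word_action:
  assumes "frobenius_pair TYPE('k::field) c"
  shows "\<exists>gs\<in>lists generators. word_action gs (Some unit_pair) = Some c"
  using assms
proof (induction "pair_size c" arbitrary: c rule: less_induct)
  case less
  show ?case
  proof (cases "c = unit_pair")
    case True
    then have "word_action [] (Some unit_pair) = Some c" by simp
    then show ?thesis by blast
  next
    case False
    then obtain g a where g: "g \<in> generators" "g (Some a) = Some c" "pair_size a < pair_size c"
      using generator_onto less.prems by blast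
    then have "frobenius_pair TYPE('k) a" using generator_frobenius_pair less.prems by blast
    then obtain gs where "gs \<in> lists generators" "word_action gs (Some unit_pair) = Some a"
      using less.hyps g by blast
    then have "g # gs \<in> lists generators" "word_action (g # gs) (Some unit_pair) = Some c"
      using g by auto
    then show ?thesis by blast
  qed
qed

theorem theorem2p6:
  shows "bij_betw (\<lambda>w. w (Some unit_pair))
           {w \<in> operator_monoid. w (Some unit_pair) \<noteq> None}
           (Some ` frobenius_pairs TYPE('k::{alg_closed_field, field_char_0}))"
proof (intro bij_betw_imageI)
  show "inj_on (\<lambda>w. w (Some unit_pair)) {w \<in> operator_monoid. w (Some unit_pair) \<noteq> None}"
    using word_action_inject by (fastforce simp: inj_on_def operator_monoid_eq)
  have "frobenius_pairs TYPE('k) = {a. frobenius_pair TYPE('k) a}"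
    using frobenius_pairs_iff[where 'k = 'k] by (auto simp: frobenius_pair_def)
  then show "(\<lambda>w. w (Some unit_pair)) ` {w \<in> operator_monoid. w (Some unit_pair) \<noteq> None} =
      Some ` frobenius_pairs TYPE('k)"
    using word_action_frobenius[where 'k = 'k] frobenius_word_action[where 'k = 'k]
    by (fastforce simp: operator_monoid_eq image_iff)
qed

end
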